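(* Let $R$ be a left Artinian ring, $s\in R$ be a non-nilpotent element of $R$, $e=e(s)$ be the idempotent associated with the element $s$, $S_e=\{1,e\}$ and $S_s=\{s^i:i\in\mathbb N\}$. The following statements are equivalent. 1. $S_s\in\mathrm{Den}_l(R)$. 2. $S_e\in\mathrm{Den}_l(R)$ and $(1-e)s(1-e)$ is a nilpotent element. 3. $eR(1-e)=0$ and $(1-e)s(1-e)$ is a nilpotent element. If one of the equivalent conditions holds then $\mathrm{ass}(S_s)=(1-e)R$ and $S_s^{-1}R\simeq S_e^{-1}R\simeq R/(1-e)R$, and the core $S_{s,c}$ of the left denominator set $S_s$ is equal to $\{s^i: i\in\mathbb N,\ (1-e)s^i(1-e)=0\}$.
   Context: Rings are associative with $1\neq0$; $\mathbb N=\{0,1,2,\dots\}$. A multiplicative set $S\subseteq R$ satisfies $1\in S$, $SS\subseteq S$, $0\notin S$. It is a left Ore set if $Sr\cap Rs\neq\emptyset$ for all $r\in R$, $s\in S$; put $\mathrm{ass}(S)=\{r\in R:sr=0\text{ for some }s\in S\}$. A left Ore set $S$ is a left denominator set if $rs=0$ with $r\in R$, $s\in S$ implies $tr=0$ for some $t\in S$; $\mathrm{Den}_l(R)$ is the set of left denominator sets and $S^{-1}R$ denotes the left localization. The core $S_c$ of a left Ore set $S$ is $S_c=\{s\in S:\ker(s\,\cdot)=\mathrm{ass}(S)\}$, where $s\,\cdot:R\to R$, $r\mapsto sr$. The idempotent associated with $s$: for $R$ left Artinian and $s\in R$, let $\cdot\, s:R\to R$, $r\mapsto rs$. Let $n=n(s)$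 be the least natural number with $Rs^n=Rs^i$ for all $i\geq n$. Then $R=Rs^i\oplus\ker(\cdot\, s^i)$ as left ideals for all $i\geq n$, with $Rs^i=Rs^n$ and $\ker(\cdot\, s^i)=\ker(\cdot\, s^n)$. Let $1=e(s)+e'(s)$ be the corresponding decomposition of $1$ with $e(s)\in Rs^n$ and $e'(s)\in\ker(\cdot\, s^n)$; $e(s)$ and $e'(s)$ are orthogonal idempotents, and $e(s)$ is the idempotent associated with $s$ (it is nonzero when $s$ is not nilpotent). *)

theory Defs
  imports "HOL-Algebra.QuotRing"
begin

definition nilpotent_elem :: "('a, 'b) ring_scheme \<Rightarrow> 'a \<Rightarrow> bool" where
  "nilpotent_elem R x \<longleftrightarrow> (\<exists>n::nat. x [^]\<^bsub>R\<^esub> n = \<zero>\<^bsub>R\<^esub>)"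

(* The notion called ideal in HOL-Algebra is two-sided. *)
definition left_ideal :: "'a set \<Rightarrow> ('a, 'b) ring_scheme \<Rightarrow> bool" where
  "left_ideal I R \<longleftrightarrow>
     additive_subgroup I R \<and> (\<forall>r\<in>carrier R. \<forall>x\<in>I. r \<otimes>\<^bsub>R\<^esub> x \<in> I)"

definition left_artinian :: "('a, 'b) ring_scheme \<Rightarrow> bool" where
  "left_artinian R \<longleftrightarrow>
     (\<forall>I :: nat \<Rightarrow> 'a set. (\<forall>n. left_ideal (I n) R) \<and> (\<forall>n. I (Suc n) \<subseteq> I n)
        \<longrightarrow> (\<exists>N. \<forall>n\<ge>N. I n = I N))"

definition multiplicative_set :: "('a, 'b) ring_scheme \<Rightarrow> 'a set \<Rightarrow> bool" where
  "multiplicative_set R S \<longleftrightarrow>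
     S \<subseteq> carrier R \<and> \<one>\<^bsub>R\<^esub> \<in> S \<and> (\<forall>s\<in>S. \<forall>t\<in>S. s \<otimes>\<^bsub>R\<^esub> t \<in> S) \<and> \<zero>\<^bsub>R\<^esub> \<notin> S"

(* S #> r is S r = {s r | s in S}, and carrier R #> s is R s. *)
definition left_ore_set :: "('a, 'b) ring_scheme \<Rightarrow> 'a set \<Rightarrow> bool" where
  "left_ore_set R S \<longleftrightarrow>
     multiplicative_set R S \<and>
     (\<forall>r\<in>carrier R. \<forall>s\<in>S. (S #>\<^bsub>R\<^esub> r) \<inter> (carrier R #>\<^bsub>R\<^esub> s) \<noteq> {})"

definition ass :: "('a, 'b) ring_scheme \<Rightarrow> 'a set \<Rightarrow> 'a set" where
  "ass R S = {r \<in> carrier R. \<exists>s\<in>S. s \<otimes>\<^bsub>R\<^esub> r = \<zero>\<^bsub>R\<^esub>}"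

definition Den_l :: "('a, 'b) ring_scheme \<Rightarrow> 'a set set" where
  "Den_l R =
     {S. left_ore_set R S \<and>
         (\<forall>r\<in>carrier R. \<forall>s\<in>S. r \<otimes>\<^bsub>R\<^esub> s = \<zero>\<^bsub>R\<^esub> \<longrightarrow> (\<exists>t\<in>S. t \<otimes>\<^bsub>R\<^esub> r = \<zero>\<^bsub>R\<^esub>))}"

definition left_mult_ker :: "('a, 'b) ring_scheme \<Rightarrow> 'a \<Rightarrow> 'a set" where
  "left_mult_ker R s = {r \<in> carrier R. s \<otimes>\<^bsub>R\<^esub> r = \<zero>\<^bsub>R\<^esub>}"

definition right_mult_ker :: "('a, 'b) ring_scheme \<Rightarrow> 'a \<Rightarrow> 'a set" where
  "right_mult_ker R s = {r \<in> carrier R. r \<otimes>\<^bsub>R\<^esub> s = \<zero>\<^bsub>R\<^esub>}"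

definition ore_core :: "('a, 'b) ring_scheme \<Rightarrow> 'a set \<Rightarrow> 'a set" where
  "ore_core R S = {s \<in> S. left_mult_ker R s = ass R S}"

(* The pair (s, r) stands for the fraction s^-1 r: two fractions are equal iff they
   have a common expansion (c s)^-1 (c r) = (d t)^-1 (d q) with denominator in S. *)
definition frac_rel ::
  "('a, 'b) ring_scheme \<Rightarrow> 'a set \<Rightarrow> (('a \<times> 'a) \<times> ('a \<times> 'a)) set" where
  "frac_rel R S =
     {((s, r), (t, q)) | s r t q.
        s \<in> S \<and> r \<in> carrier R \<and> t \<in> S \<and> q \<in> carrier R \<and>
        (\<exists>c\<in>carrier R. \<exists>d\<in>carrier R.
           c \<otimes>\<^bsub>R\<^esub> s = d \<otimes>\<^bsub>R\<^esub> t \<and> c \<otimes>\<^bsub>R\<^esub> s \<in> S \<and> c \<otimes>\<^bsub>R\<^esub> r = d \<otimes>\<^bsub>R\<^esub> q)}"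

definition frac :: "('a, 'b) ring_scheme \<Rightarrow> 'a set \<Rightarrow> 'a \<Rightarrow> 'a \<Rightarrow> ('a \<times> 'a) set" where
  "frac R S s r = frac_rel R S `` {(s, r)}"

(* Intended for S in Den_l R. Then the classes of which the unions are taken all
   coincide: s^-1 r t^-1 q = (c s)^-1 (d q) for any c in S and d in R with c r = d t,
   and s^-1 r + t^-1 q = (c s)^-1 (c r + d q) for any c, d in R with c s = d t in S. *)
definition left_localization ::
  "('a, 'b) ring_scheme \<Rightarrow> 'a set \<Rightarrow> ('a \<times> 'a) set ring" where
  "left_localization R S =
     \<lparr>carrier = (S \<times> carrier R) // frac_rel R S,
      mult = (\<lambda>A B. \<Union>{frac R S (c \<otimes>\<^bsub>R\<^esub> s) (d \<otimes>\<^bsub>R\<^esub> q) | s r t q c d.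
                (s, r) \<in> A \<and> (t, q) \<in> B \<and> c \<in> S \<and> d \<in> carrier R \<and>
                c \<otimes>\<^bsub>R\<^esub> r = d \<otimes>\<^bsub>R\<^esub> t}),
      one = frac R S \<one>\<^bsub>R\<^esub> \<one>\<^bsub>R\<^esub>,
      zero = frac R S \<one>\<^bsub>R\<^esub> \<zero>\<^bsub>R\<^esub>,
      add = (\<lambda>A B. \<Union>{frac R S (c \<otimes>\<^bsub>R\<^esub> s) (c \<otimes>\<^bsub>R\<^esub> r \<oplus>\<^bsub>R\<^esub> d \<otimes>\<^bsub>R\<^esub> q) | s r t q c d.
                (s, r) \<in> A \<and> (t, q) \<in> B \<and> c \<in> carrier R \<and> d \<in> carrier R \<and>
                c \<otimes>\<^bsub>R\<^esub> s = d \<otimes>\<^bsub>R\<^esub> t \<and> c \<otimes>\<^bsub>R\<^esub> s \<in> S})\<rparr>"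

definition stab_index :: "('a, 'b) ring_scheme \<Rightarrow> 'a \<Rightarrow> nat" where
  "stab_index R s =
     (LEAST n. \<forall>i\<ge>n. carrier R #>\<^bsub>R\<^esub> (s [^]\<^bsub>R\<^esub> n) = carrier R #>\<^bsub>R\<^esub> (s [^]\<^bsub>R\<^esub> i))"

(* The component in R s^n of 1, along R = R s^n + ker(. s^n) (direct sum), n = n(s);
   meaningful for R left Artinian. *)
definition assoc_idem :: "('a, 'b) ring_scheme \<Rightarrow> 'a \<Rightarrow> 'a" where
  "assoc_idem R s =
     (THE e. e \<in> carrier R #>\<^bsub>R\<^esub> (s [^]\<^bsub>R\<^esub> stab_index R s) \<and>
        (\<exists>e' \<in> right_mult_ker R (s [^]\<^bsub>R\<^esub> stab_index R s). \<one>\<^bsub>R\<^esub> = e \<oplus>\<^bsub>R\<^esub> e'))"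

end

theory Submission
  imports Defs "HOL-Algebra.Ideal_Product"
begin

text \<open>
  Everything rests on one fact about \<open>x = s\<^sup>n\<close>, where \<open>Rx = Rx\<^sup>2\<close>: right multiplication by
  \<open>x\<close> is injective on \<open>Rx\<close>. It makes the decomposition of \<open>1\<close> unique, and since
  elements of \<open>Rx\<close> may now be compared after multiplication by powers of \<open>s\<close>, it shows that
  \<open>e\<close> commutes with \<open>s\<close>, that \<open>s\<^sup>n e = s\<^sup>n\<close>, and that every \<open>s\<^sup>i\<close> has
  a \<open>v\<close> with \<open>v s\<^sup>i = e = s\<^sup>i v\<close> (locale \<open>fitting_idempotent\<close>).
  So some power of \<open>s\<close> kills \<open>r\<close> from the left exactly if \<open>e\<close> does, that is, exactly if
  \<open>r \<in> e'R\<close> with \<open>e' = 1 - e\<close>. In particular \<open>e'\<close> kills \<open>s\<^sup>n\<close> and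
  \<open>e's = se'\<close>, so that \<open>e'se'\<close> is nilpotent, and all three conditions come down
  to \<open>eRe' = 0\<close>: an element \<open>e r e'\<close> is killed from the right by \<open>s\<^sup>n\<close> and by \<open>e\<close>, while
  nonzero elements of \<open>eR\<close> are killed from the left by none of the denominators; conversely \<open>er = ere\<close>
  gives \<open>s\<^sup>n r \<in> Rs\<^sup>i\<close> for all \<open>i\<close>, hence the Ore condition.

  Both localizations are \<open>R/e'R\<close> by the characterization of a left localization as a ring of
  fractions \<open>\<phi>(s)\<^sup>-\<^sup>1 \<phi>(r)\<close> under a ring map \<open>\<phi>\<close> with kernel \<open>ass S\<close>
  that inverts \<open>S\<close> (\<open>left_localization_iso\<close>): modulo \<open>e'R\<close> the idempotent \<open>e\<close>
  becomes \<open>1\<close> and the powers of \<open>s\<close> become units.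

  A surjective endomorphism of an Artinian module need not be injective, so injectivity on \<open>Rx\<close> uses that
  the whole ring is left Artinian. Usually one quotes that \<open>R\<close> is then also left Noetherian; here the
  argument is direct. First it is shown modulo the Jacobson radical \<open>J\<close>: a kernel not contained in
  \<open>J\<close> has an element \<open>q\<close> that is idempotent modulo \<open>J\<close> and nonzero there, and
  repeated division of \<open>q\<close> by \<open>x\<close> produces a strictly descending chain of left annihilators
  (\<open>right_mult_kernel_in_jacobson\<close>). This yields \<open>x - x\<^sup>2 b \<in> J\<close>, and because \<open>J\<close> is
  nilpotent, some power of \<open>x\<close> is a right multiple of all later powers
  (\<open>power_mem_right_multiples\<close>), which gives injectivity in \<open>R\<close>.
\<close>

section \<open>Left ideals and the Jacobson radical\<close>

locale left_artinian_ring = ring +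
  assumes artinian: "left_artinian R"

context ring
begin

lemma mem_principal: "y \<in> carrier R #> a \<longleftrightarrow> (\<exists>r\<in>carrier R. y = r \<otimes> a)"
  by (auto simp: r_coset_def)

lemma pow_mult_left: "a \<in> carrier R \<Longrightarrow> a \<otimes> a [^] (n::nat) = a [^] n \<otimes> a"
  using nat_pow_Suc2[of a n] by simp

lemma pow_mult_left_assoc:
  "\<lbrakk>a \<in> carrier R; b \<in> carrier R\<rbrakk> \<Longrightarrow> a \<otimes> (a [^] (n::nat) \<otimes> b) = a [^] n \<otimes> (a \<otimes> b)"
  by (simp add: m_assoc[symmetric] pow_mult_left)

lemma minus_eq_zero_iff:
  "\<lbrakk>x \<in> carrier R; y \<in> carrier R\<rbrakk> \<Longrightarrow> x \<ominus> y = \<zero> \<longleftrightarrow> x = y"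
  by (metis a_inv_closed a_minus_def minus_equality minus_minus r_neg)

lemma minus_plus_cancel:
  "\<lbrakk>x \<in> carrier R; y \<in> carrier R; z \<in> carrier R\<rbrakk> \<Longrightarrow> (x \<ominus> y) \<oplus> (y \<ominus> z) = x \<ominus> z"
  by (simp add: minus_eq a_assoc r_neg2 r_neg1)

lemma left_idealI:
  assumes "I \<subseteq> carrier R" "\<zero> \<in> I"
    and "\<And>x y. x \<in> I \<Longrightarrow> y \<in> I \<Longrightarrow> x \<oplus> y \<in> I"
    and mult: "\<And>r x. r \<in> carrier R \<Longrightarrow> x \<in> I \<Longrightarrow> r \<otimes> x \<in> I"
  shows "left_ideal I R"
proof -
  have "\<ominus> x \<in> I" if "x \<in> I" for x
    using mult[of "\<ominus> \<one>" x] that assms(1) by (auto simp: l_minus)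
  then have "subgroup I (add_monoid R)"
    using assms by unfold_locales (auto simp: a_inv_def)
  then show ?thesis
    using mult by (simp add: left_ideal_def additive_subgroup_def)
qed

lemma left_idealD:
  assumes "left_ideal I R"
  shows "I \<subseteq> carrier R" "\<zero> \<in> I"
    and "\<And>x y. x \<in> I \<Longrightarrow> y \<in> I \<Longrightarrow> x \<oplus> y \<in> I"
    and "\<And>r x. r \<in> carrier R \<Longrightarrow> x \<in> I \<Longrightarrow> r \<otimes> x \<in> I"
    and "\<And>x y. x \<in> I \<Longrightarrow> y \<in> I \<Longrightarrow> x \<ominus> y \<in> I"
proof -
  interpret additive_subgroup I R
    using assms by (simp add: left_ideal_def)
  show "I \<subseteq> carrier R" "\<zero> \<in> I"
    and "\<And>x y. x \<in> I \<Longrightarrow> y \<in> I \<Longrightarrow> x \<oplus> y \<in> I"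
    by (auto simp: a_subset)
  show mult: "\<And>r x. r \<in> carrier R \<Longrightarrow> x \<in> I \<Longrightarrow> r \<otimes> x \<in> I"
    using assms by (simp add: left_ideal_def)
  show "\<And>x y. x \<in> I \<Longrightarrow> y \<in> I \<Longrightarrow> x \<ominus> y \<in> I"
    using mult[of "\<ominus> \<one>"] by (auto simp: minus_eq l_minus)
qed

lemma left_ideal_principal:
  assumes "a \<in> carrier R"
  shows "left_ideal (carrier R #> a) R"
proof (rule left_idealI)
  show "carrier R #> a \<subseteq> carrier R" "\<zero> \<in> carrier R #> a"
    using assms by (auto simp: mem_principal intro!: bexI[of _ \<zero>])
  show "x \<oplus> y \<in> carrier R #> a" if "x \<in> carrier R #> a" "y \<in> carrier R #> a" for x y
    using that assms by (auto simp: mem_principal l_distr[symmetric])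
  show "r \<otimes> x \<in> carrier R #> a" if "r \<in> carrier R" "x \<in> carrier R #> a" for r x
    using that assms by (auto simp: mem_principal m_assoc[symmetric])
qed

lemma left_ideal_image:
  assumes "left_ideal I R" "a \<in> carrier R"
  shows "left_ideal ((\<lambda>x. x \<otimes> a) ` I) R"
proof -
  note I = left_idealD[OF assms(1)]
  show ?thesis
  proof (rule left_idealI)
    show "(\<lambda>x. x \<otimes> a) ` I \<subseteq> carrier R" using I(1) assms(2) by auto
    show "\<zero> \<in> (\<lambda>x. x \<otimes> a) ` I" using I(2) assms(2) by force
    fix x y assume "x \<in> (\<lambda>x. x \<otimes> a) ` I" "y \<in> (\<lambda>x. x \<otimes> a) ` I"
    then obtain u v where "u \<in> I" "v \<in> I" "x = u \<otimes> a" "y = v \<otimes> a" by blast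
    then have "x \<oplus> y = (u \<oplus> v) \<otimes> a" "u \<oplus> v \<in> I"
      using I assms(2) by (auto simp: l_distr subset_iff)
    then show "x \<oplus> y \<in> (\<lambda>x. x \<otimes> a) ` I" by blast
  next
    fix r x assume r: "r \<in> carrier R" and "x \<in> (\<lambda>x. x \<otimes> a) ` I"
    then obtain u where u: "u \<in> I" "x = u \<otimes> a" by blast
    then have "r \<otimes> x = (r \<otimes> u) \<otimes> a" "r \<otimes> u \<in> I"
      using I assms(2) r by (auto simp: m_assoc subset_iff)
    then show "r \<otimes> x \<in> (\<lambda>x. x \<otimes> a) ` I" by blast
  qed
qed

text \<open>The geometric sum \<open>1 + z + \<dots> + z\<^sup>n\<^sup>-\<^sup>1\<close> is the witness; it inverts \<open>1 - z\<close> when \<open>z\<close> is nilpotent.\<close>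
lemma geometric_left_inverse:
  assumes z: "z \<in> carrier R"
  shows "\<exists>u\<in>carrier R. u \<otimes> (\<one> \<ominus> z) = \<one> \<ominus> z [^] (n::nat)"
proof (induction n)
  case 0
  show ?case using z by (intro bexI[of _ \<zero>]) (auto simp: minus_eq r_neg)
next
  case (Suc n)
  then obtain u where u: "u \<in> carrier R" "u \<otimes> (\<one> \<ominus> z) = \<one> \<ominus> z [^] n" by blast
  have "(u \<oplus> z [^] n) \<otimes> (\<one> \<ominus> z) = (\<one> \<ominus> z [^] n) \<oplus> z [^] n \<otimes> (\<one> \<ominus> z)"
    using z u by (simp add: l_distr)
  also have "\<dots> = (\<one> \<ominus> z [^] n) \<oplus> (z [^] n \<ominus> z [^] n \<otimes> z)"
    using z by (simp add: minus_eq r_distr r_minus)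
  also have "\<dots> = \<one> \<ominus> z [^] n \<otimes> z"
    using z by (intro minus_plus_cancel) auto
  finally show ?case using u z by (intro bexI[of _ "u \<oplus> z [^] n"]) auto
qed

text \<open>The Jacobson radical in its elementwise description, which makes its closure properties and its nilness accessible without maximal left ideals.\<close>
definition jacobson :: "'a set" where
  "jacobson = {a \<in> carrier R. \<forall>r\<in>carrier R. \<exists>u\<in>carrier R. u \<otimes> (\<one> \<ominus> r \<otimes> a) = \<one>}"

lemma nil_left_ideal_subset_jacobson:
  assumes L: "left_ideal L R" and nil: "\<And>z. z \<in> L \<Longrightarrow> nilpotent_elem R z"
  shows "L \<subseteq> jacobson"
proof
  fix a assume a: "a \<in> L"
  note LD = left_idealD[OF L]
  have "\<exists>u\<in>carrier R. u \<otimes> (\<one> \<ominus> r \<otimes> a) = \<one>" if r: "r \<in> carrier R" for r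
  proof -
    have ra: "r \<otimes> a \<in> L" using a r LD by blast
    then obtain n where n: "(r \<otimes> a) [^] (n::nat) = \<zero>"
      using nil by (auto simp: nilpotent_elem_def)
    have "r \<otimes> a \<in> carrier R" using ra LD by blast
    from geometric_left_inverse[OF this, of n] show ?thesis
      by (simp add: n minus_eq)
  qed
  then show "a \<in> jacobson" using a LD(1) by (auto simp: jacobson_def)
qed

text \<open>Closure under sums: a left inverse \<open>u\<close> of \<open>1 - ra\<close> turns \<open>1 - r(a + b)\<close> into
  \<open>1 - urb\<close>. Closure under right multiplication: a left inverse \<open>u\<close> of \<open>1 - tp\<close> gives the
  left inverse \<open>1 + put\<close> of \<open>1 - pt\<close>.\<close>
lemma jacobson_ideal: "ideal jacobson R"
proof -
  have left: "r \<otimes> a \<in> jacobson" if "r \<in> carrier R" "a \<in> jacobson" for r a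
    using that by (fastforce simp: jacobson_def m_assoc[symmetric])
  have sum: "a \<oplus> b \<in> jacobson" if a: "a \<in> jacobson" and b: "b \<in> jacobson" for a b
  proof -
    have c: "a \<in> carrier R" "b \<in> carrier R" using a b by (auto simp: jacobson_def)
    have "\<exists>w\<in>carrier R. w \<otimes> (\<one> \<ominus> r \<otimes> (a \<oplus> b)) = \<one>" if r: "r \<in> carrier R" for r
    proof -
      obtain u where u: "u \<in> carrier R" "u \<otimes> (\<one> \<ominus> r \<otimes> a) = \<one>"
        using a r by (auto simp: jacobson_def)
      obtain v where v: "v \<in> carrier R" "v \<otimes> (\<one> \<ominus> (u \<otimes> r) \<otimes> b) = \<one>"
        using b r u(1) by (auto simp: jacobson_def)
      have "\<one> \<ominus> r \<otimes> (a \<oplus> b) = (\<one> \<ominus> r \<otimes> a) \<ominus> r \<otimes> b"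
        using c r by algebra
      then have "u \<otimes> (\<one> \<ominus> r \<otimes> (a \<oplus> b)) = u \<otimes> (\<one> \<ominus> r \<otimes> a) \<ominus> u \<otimes> (r \<otimes> b)"
        using c r u(1) by (simp add: minus_eq r_distr r_minus)
      also have "\<dots> = \<one> \<ominus> (u \<otimes> r) \<otimes> b"
        using c r u by (simp add: m_assoc)
      finally have "(v \<otimes> u) \<otimes> (\<one> \<ominus> r \<otimes> (a \<oplus> b)) = \<one>"
        using c r u(1) v by (simp add: m_assoc)
      then show ?thesis using u v by blast
    qed
    then show ?thesis using c by (auto simp: jacobson_def)
  qed
  have right: "a \<otimes> t \<in> jacobson" if a: "a \<in> jacobson" and t: "t \<in> carrier R" for a t
  proof -
    have c: "a \<in> carrier R" using a by (auto simp: jacobson_def)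
    have "\<exists>w\<in>carrier R. w \<otimes> (\<one> \<ominus> r \<otimes> (a \<otimes> t)) = \<one>" if r: "r \<in> carrier R" for r
    proof -
      define p where "p = r \<otimes> a"
      have p: "p \<in> carrier R" using r c by (simp add: p_def)
      obtain u where u: "u \<in> carrier R" "u \<otimes> (\<one> \<ominus> (t \<otimes> r) \<otimes> a) = \<one>"
        using a r t by (auto simp: jacobson_def)
      then have u2: "u \<otimes> (\<one> \<ominus> t \<otimes> p) = \<one>"
        using r c t by (simp add: p_def m_assoc)
      have "(\<one> \<oplus> p \<otimes> u \<otimes> t) \<otimes> (\<one> \<ominus> p \<otimes> t)
          = (\<one> \<ominus> p \<otimes> t) \<oplus> p \<otimes> (u \<otimes> (\<one> \<ominus> t \<otimes> p)) \<otimes> t"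
        using p t u(1) by (simp add: minus_eq l_distr r_distr l_minus r_minus m_assoc minus_add a_ac)
      also have "\<dots> = \<one>" unfolding u2 using p t by algebra
      finally have "(\<one> \<oplus> p \<otimes> u \<otimes> t) \<otimes> (\<one> \<ominus> r \<otimes> (a \<otimes> t)) = \<one>"
        using r c t by (simp add: p_def m_assoc)
      then show ?thesis using p u t by blast
    qed
    then show ?thesis using c t by (auto simp: jacobson_def)
  qed
  have "left_ideal jacobson R"
    by (rule left_idealI) (auto simp: left sum, auto simp: jacobson_def minus_eq)
  then show ?thesis
    by (intro idealI) (auto simp: left right left_ideal_def additive_subgroup_def ring_axioms)
qed

end

context left_artinian_ring
begin

text \<open>The descending chain condition in the form of a minimal condition, by dependent choice.\<close>
lemma minimal_left_ideal:
  assumes F: "I0 \<in> F" "\<And>I. I \<in> F \<Longrightarrow> left_ideal I R"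
  obtains I where "I \<in> F" "\<And>K. K \<in> F \<Longrightarrow> K \<subseteq> I \<Longrightarrow> K = I"
proof (rule ccontr)
  assume "\<not> thesis"
  then have "\<exists>K. K \<in> F \<and> K \<subset> I" if "I \<in> F" for I
    using that \<open>\<And>I. \<lbrakk>I \<in> F; \<And>K. \<lbrakk>K \<in> F; K \<subseteq> I\<rbrakk> \<Longrightarrow> K = I\<rbrakk> \<Longrightarrow> thesis\<close> by blast
  then obtain f where f: "\<And>I. I \<in> F \<Longrightarrow> f I \<in> F \<and> f I \<subset> I" by metis
  define C where "C = rec_nat I0 (\<lambda>_. f)"
  have C: "C n \<in> F" for n
    by (induction n) (auto simp: C_def F f)
  have strict: "C (Suc n) \<subset> C n" for n
    using f[OF C[of n]] by (simp add: C_def)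
  have "(\<forall>n. left_ideal (C n) R) \<and> (\<forall>n. C (Suc n) \<subseteq> C n)"
    using C F(2) strict by blast
  then obtain N where "\<forall>n\<ge>N. C n = C N"
    using artinian unfolding left_artinian_def by blast
  then show False using strict[of N] by (metis lessI less_imp_le_nat order_less_irrefl)
qed

lemma principal_powers_stabilize:
  assumes a: "a \<in> carrier R"
  shows "\<exists>n. \<forall>i\<ge>n. carrier R #> (a [^] (n::nat)) = carrier R #> (a [^] (i::nat))"
proof -
  have "carrier R #> (a [^] Suc n) \<subseteq> carrier R #> (a [^] n)" for n :: nat
  proof
    fix y assume "y \<in> carrier R #> (a [^] Suc n)"
    then obtain r where r: "r \<in> carrier R" "y = r \<otimes> a [^] Suc n"
      by (auto simp: mem_principal)
    then have "y = (r \<otimes> a) \<otimes> a [^] n"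
      using a by (simp add: pow_mult_left m_assoc)
    then show "y \<in> carrier R #> (a [^] n)" using r a by (auto simp: mem_principal)
  qed
  moreover have "left_ideal (carrier R #> (a [^] n)) R" for n :: nat
    using a by (simp add: left_ideal_principal)
  ultimately obtain N where "\<forall>n\<ge>N::nat. carrier R #> (a [^] n) = carrier R #> (a [^] N)"
    using artinian[unfolded left_artinian_def, rule_format, of "\<lambda>n. carrier R #> (a [^] (n::nat))"]
    by blast
  then show ?thesis by metis
qed

text \<open>By the chain condition \<open>a\<^sup>n = d a\<^sup>n\<^sup>+\<^sup>1\<close>, so the left invertible element \<open>1 - da\<close> kills \<open>a\<^sup>n\<close>.\<close>
lemma jacobson_nil:
  assumes a: "a \<in> jacobson"
  shows "nilpotent_elem R a"
proof -
  have c: "a \<in> carrier R" using a by (auto simp: jacobson_def)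
  obtain n where "carrier R #> (a [^] (n::nat)) = carrier R #> (a [^] Suc n)"
    using principal_powers_stabilize[OF c] by (meson le_SucI le_refl)
  then obtain d where d: "d \<in> carrier R" "a [^] n = d \<otimes> a [^] Suc n"
    using c by (metis mem_principal l_one nat_pow_closed one_closed)
  obtain u where u: "u \<in> carrier R" "u \<otimes> (\<one> \<ominus> d \<otimes> a) = \<one>"
    using a d by (auto simp: jacobson_def)
  have "(\<one> \<ominus> d \<otimes> a) \<otimes> a [^] n = a [^] n \<ominus> d \<otimes> a [^] Suc n"
    using c d(1) by (simp add: minus_eq l_distr l_minus m_assoc pow_mult_left)
  also have "\<dots> = \<zero>" using c d by (metis minus_eq_zero_iff nat_pow_closed)
  finally have "u \<otimes> (\<one> \<ominus> d \<otimes> a) \<otimes> a [^] n = \<zero>" using c d(1) u(1) by (simp add: m_assoc)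
  then show ?thesis using u c by (auto simp: nilpotent_elem_def)
qed

end

section \<open>Injectivity of right multiplication on stable images\<close>

context ring
begin

primrec ideal_power :: "'a set \<Rightarrow> nat \<Rightarrow> 'a set" where
  "ideal_power J 0 = carrier R"
| "ideal_power J (Suc n) = ideal_power J n \<cdot> J"

lemma ideal_power_ideal:
  assumes "ideal J R"
  shows "ideal (ideal_power J n) R"
  by (induction n) (auto intro: oneideal ideal_prod_is_ideal assms)

text \<open>The powers are built by multiplying by \<open>J\<close> on the right; this is the same from the left.\<close>
lemma mult_mem_ideal_power:
  assumes J: "ideal J R" and j: "j \<in> J" and a: "a \<in> ideal_power J n"
  shows "j \<otimes> a \<in> ideal_power J (Suc n)"
  using a
proof (induction n arbitrary: a)
  case 0
  interpret J: ideal J R by fact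
  have "\<one> \<otimes> (j \<otimes> a) \<in> carrier R \<cdot> J"
    using 0 j by (intro ideal_prod.prod) (auto intro: J.I_r_closed)
  then show ?case using 0 j J.Icarr by auto
next
  case (Suc n)
  interpret J: ideal J R by fact
  interpret P: ideal "ideal_power J n" R using J by (rule ideal_power_ideal)
  have "a \<in> ideal_power J n \<cdot> J" using Suc.prems by simp
  then have "a \<in> carrier R \<and> j \<otimes> a \<in> ideal_power J (Suc n) \<cdot> J"
  proof induction
    case (prod p i)
    then have "(j \<otimes> p) \<otimes> i \<in> ideal_power J (Suc n) \<cdot> J"
      by (intro ideal_prod.prod Suc.IH)
    then show ?case using prod j J.Icarr P.Icarr by (simp add: m_assoc)
  next
    case (sum a b)
    then have "j \<otimes> a \<oplus> j \<otimes> b \<in> ideal_power J (Suc n) \<cdot> J"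
      by (blast intro: ideal_prod.sum)
    then show ?case using sum j J.Icarr by (simp add: r_distr)
  qed
  then show ?case by simp
qed

text \<open>Right \<open>\<pi>\<close>-regularity lifts modulo a nilpotent ideal. Multiplied by an element \<open>a\<close> of
  \<open>J\<^sup>m\<^sup>-\<^sup>d\<close>, the power \<open>x\<^sup>d\<close> lies in all \<open>x\<^sup>k R\<close>: replace one factor
  \<open>x\<close> by \<open>x\<^sup>2 b + j\<close>. The first term is again of the same kind and has gained a factor
  \<open>x\<close>, the second has one factor \<open>x\<close> less but \<open>ja\<close> lies in a higher power of \<open>J\<close>.
  For \<open>d = m\<close> one may take \<open>a = 1\<close>.\<close>
lemma power_mem_right_multiples:
  assumes J: "ideal J R" and nilp: "ideal_power J m = {\<zero>}"
    and x: "x \<in> carrier R" and b: "b \<in> carrier R" and xb: "x \<ominus> x \<otimes> x \<otimes> b \<in> J"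
  shows "\<exists>t\<in>carrier R. x [^] m = x [^] (k::nat) \<otimes> t"
proof -
  interpret J: ideal J R by fact
  define j where "j = x \<ominus> x \<otimes> x \<otimes> b"
  have j: "j \<in> J" "j \<in> carrier R" using xb J.Icarr by (auto simp: j_def)
  have x_eq: "x = x \<otimes> x \<otimes> b \<oplus> j"
    using x b by (simp add: j_def minus_eq a_ac r_neg r_neg1)
  have main: "d \<le> m \<Longrightarrow> a \<in> ideal_power J (m - d)
      \<Longrightarrow> \<exists>t\<in>carrier R. x [^] d \<otimes> a = x [^] k \<otimes> t" for a d and k :: nat
  proof (induction d arbitrary: a k)
    case 0
    then have "a = \<zero>" using nilp by simp
    then show ?case using x by (intro bexI[of _ \<zero>]) auto
  next
    case (Suc d)
    interpret P: ideal "ideal_power J (m - Suc d)" R using J by (rule ideal_power_ideal)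
    show ?case using Suc.prems(2)
    proof (induction k arbitrary: a)
      case 0
      then show ?case using x P.Icarr by (intro bexI[of _ "x [^] Suc d \<otimes> a"]) auto
    next
      case (Suc k)
      have a: "a \<in> carrier R" using Suc.prems P.Icarr by blast
      have ba: "b \<otimes> a \<in> ideal_power J (m - Suc d)"
        using Suc.prems b by (rule P.I_l_closed)
      obtain t where t: "t \<in> carrier R" "x [^] Suc d \<otimes> (b \<otimes> a) = x [^] k \<otimes> t"
        using Suc.IH[OF ba] by blast
      have "j \<otimes> a \<in> ideal_power J (Suc (m - Suc d))"
        using J j(1) Suc.prems by (rule mult_mem_ideal_power)
      then have "j \<otimes> a \<in> ideal_power J (m - d)"
        using \<open>Suc d \<le> m\<close> by (simp add: Suc_diff_Suc)
      then obtain t' where t': "t' \<in> carrier R" "x [^] d \<otimes> (j \<otimes> a) = x [^] Suc k \<otimes> t'"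
        using \<open>Suc d \<le> m\<close> \<open>\<And>k a. d \<le> m \<Longrightarrow> a \<in> ideal_power J (m - d) \<Longrightarrow> \<exists>t\<in>carrier R. x [^] d \<otimes> a = x [^] k \<otimes> t\<close>
        by (meson Suc_leD)
      have "x [^] Suc d \<otimes> a = x [^] d \<otimes> (x \<otimes> a)"
        using x a by (simp add: m_assoc)
      also have "x \<otimes> a = x \<otimes> (x \<otimes> (b \<otimes> a)) \<oplus> j \<otimes> a"
        using x b a j by (subst x_eq) (simp add: l_distr m_assoc)
      also have "x [^] d \<otimes> \<dots> = x [^] d \<otimes> x \<otimes> (x \<otimes> (b \<otimes> a)) \<oplus> x [^] d \<otimes> (j \<otimes> a)"
        using x b a j by (simp add: r_distr m_assoc)
      also have "x [^] d \<otimes> x \<otimes> (x \<otimes> (b \<otimes> a)) = x \<otimes> (x [^] Suc d \<otimes> (b \<otimes> a))"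
        using x b a by (simp add: m_assoc pow_mult_left pow_mult_left_assoc)
      also have "\<dots> = x [^] Suc k \<otimes> t"
        unfolding t(2) using x t(1) by (simp add: m_assoc pow_mult_left pow_mult_left_assoc)
      also have "\<dots> \<oplus> x [^] d \<otimes> (j \<otimes> a) = x [^] Suc k \<otimes> (t \<oplus> t')"
        unfolding t'(2) using x t(1) t'(1) by (simp add: r_distr)
      finally show ?case using t(1) t'(1) by blast
    qed
  qed
  show ?thesis using main[of m \<one> k] x by simp
qed

end

context left_artinian_ring
begin

text \<open>Let \<open>P\<close> be the stable value of the powers, so \<open>PJ = P\<close>. If \<open>P \<noteq> 0\<close>, take a left ideal
  \<open>I\<close> minimal with \<open>PI \<noteq> 0\<close> and \<open>a \<in> I\<close> with \<open>Pa \<noteq> 0\<close>. Then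
  \<open>P(Ja) \<noteq> 0\<close>, so \<open>Ja = I\<close> by minimality, and \<open>a = ja\<close> with \<open>j\<close> nilpotent is impossible.\<close>
lemma nil_ideal_nilpotent:
  assumes J: "ideal J R" and nil: "\<And>a. a \<in> J \<Longrightarrow> nilpotent_elem R a"
  shows "\<exists>m. ideal_power J m = {\<zero>}"
proof -
  interpret J: ideal J R by fact
  have P_ideal: "ideal (ideal_power J n) R" for n
    using J by (rule ideal_power_ideal)
  have "left_ideal (ideal_power J n) R" for n
    using P_ideal[of n] by (simp add: left_ideal_def ideal.axioms ideal.I_l_closed)
  moreover have "ideal_power J (Suc n) \<subseteq> ideal_power J n" for n
    using ideal_prod_inter[OF P_ideal[of n] J] by simp
  ultimately obtain m where m: "\<forall>n\<ge>m. ideal_power J n = ideal_power J m"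
    using artinian[unfolded left_artinian_def, rule_format, of "ideal_power J"] by blast
  define P where "P = ideal_power J m"
  interpret P: ideal P R unfolding P_def by (rule P_ideal)
  have PJ: "P \<cdot> J = P"
    using m[rule_format, of "Suc m"] by (simp add: P_def)
  define F where "F = {I. left_ideal I R \<and> (\<exists>p\<in>P. \<exists>a\<in>I. p \<otimes> a \<noteq> \<zero>)}"
  have "P = {\<zero>}"
  proof (rule ccontr)
    assume "P \<noteq> {\<zero>}"
    then obtain p0 where "p0 \<in> P" "p0 \<noteq> \<zero>" using P.zero_closed by blast
    then have "p0 \<otimes> \<one> \<noteq> \<zero>" using P.Icarr by simp
    then have "\<exists>p\<in>P. \<exists>a\<in>carrier R. p \<otimes> a \<noteq> \<zero>"
      using \<open>p0 \<in> P\<close> by blast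
    then have "carrier R \<in> F"
      using oneideal by (auto simp: F_def left_ideal_def ideal.axioms(1))
    moreover have "left_ideal I R" if "I \<in> F" for I using that by (simp add: F_def)
    ultimately obtain I where I: "I \<in> F" "\<And>K. K \<in> F \<Longrightarrow> K \<subseteq> I \<Longrightarrow> K = I"
      using minimal_left_ideal by blast
    from I(1) obtain p a where pa: "p \<in> P" "a \<in> I" "p \<otimes> a \<noteq> \<zero>" and "left_ideal I R"
      by (auto simp: F_def)
    note ID = left_idealD[OF \<open>left_ideal I R\<close>]
    have a: "a \<in> carrier R" using pa ID by blast
    have "\<exists>q\<in>P. \<exists>j\<in>J. q \<otimes> (j \<otimes> a) \<noteq> \<zero>"
    proof (rule ccontr)
      assume *: "\<not> ?thesis"
      have "q \<in> carrier R \<and> q \<otimes> a = \<zero>" if "q \<in> P \<cdot> J" for q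
        using that
      proof induction
        case (prod q j)
        then have "q \<in> carrier R" "j \<in> carrier R" using P.Icarr J.Icarr by auto
        then show ?case using prod * a by (auto simp: m_assoc)
      next
        case (sum q r)
        then show ?case using a by (auto simp: l_distr)
      qed
      then show False using PJ pa by auto
    qed
    moreover have "left_ideal ((\<lambda>x. x \<otimes> a) ` J) R"
      by (rule left_ideal_image) (auto simp: left_ideal_def J.additive_subgroup_axioms J.I_l_closed a)
    ultimately have "(\<lambda>x. x \<otimes> a) ` J \<in> F" by (auto simp: F_def)
    moreover have "(\<lambda>x. x \<otimes> a) ` J \<subseteq> I" using pa ID J.Icarr by auto
    ultimately have "a \<in> (\<lambda>x. x \<otimes> a) ` J" using I(2) pa(2) by blast
    then obtain j where j: "j \<in> J" "a = j \<otimes> a" by blast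
    have "j [^] n \<otimes> a = a" for n :: nat
      using j(2)[symmetric] a j(1) J.Icarr by (induction n) (auto simp: m_assoc)
    moreover obtain n where "j [^] (n::nat) = \<zero>"
      using nil[OF j(1)] by (auto simp: nilpotent_elem_def)
    ultimately have "a = \<zero>" using a by (metis l_null)
    then show False using pa P.Icarr by auto
  qed
  then show ?thesis by (auto simp: P_def)
qed

text \<open>This is injectivity of right multiplication by \<open>x\<close> on the image of \<open>Rx\<close> in \<open>R/J\<close>. If the
  kernel \<open>K\<close> is not contained in \<open>J\<close>, it is not nil, and a minimal non-nil left ideal in it supplies
  an element \<open>q\<close> that is idempotent and nonzero modulo \<open>J\<close>. Since \<open>Rx = Rx\<^sup>2\<close>, it can be
  divided by \<open>x\<close> again and again inside \<open>Rx\<close>; correcting each quotient \<open>p\<close> to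
  \<open>p - pq\<close>, which changes \<open>px\<close> only by an element of \<open>J\<close>, one obtains \<open>g\<^sub>k\<close> with
  \<open>g\<^sub>k x\<^sup>k q \<equiv> q\<close> but \<open>g\<^sub>k x\<^sup>i q \<equiv> 0\<close> for \<open>i < k\<close>. So the left ideals
  of all \<open>y\<close> with \<open>y x\<^sup>i q \<in> J\<close> for \<open>i < k\<close> descend strictly as \<open>k\<close> grows.\<close>
lemma right_mult_kernel_in_jacobson:
  assumes x: "x \<in> carrier R" and stable: "carrier R #> x \<subseteq> carrier R #> (x \<otimes> x)"
    and y: "y \<in> carrier R #> x" "y \<otimes> x \<in> jacobson"
  shows "y \<in> jacobson"
proof (rule ccontr)
  assume "y \<notin> jacobson"
  interpret J: ideal jacobson R by (rule jacobson_ideal)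
  define K where "K = {y \<in> carrier R #> x. y \<otimes> x \<in> jacobson}"
  note Rx = left_idealD[OF left_ideal_principal[OF x]]
  have K: "left_ideal K R"
  proof (rule left_idealI)
    show "K \<subseteq> carrier R" "\<zero> \<in> K" using Rx x by (auto simp: K_def)
  next
    fix u v assume "u \<in> K" "v \<in> K"
    then show "u \<oplus> v \<in> K" using Rx x by (auto simp: K_def l_distr subset_iff)
  next
    fix r u assume "r \<in> carrier R" "u \<in> K"
    then show "r \<otimes> u \<in> K" using Rx x J.I_l_closed by (auto simp: K_def m_assoc subset_iff)
  qed
  define F where "F = {I. left_ideal I R \<and> I \<subseteq> K \<and> (\<exists>a\<in>I. \<not> nilpotent_elem R a)}"
  have "\<not> K \<subseteq> jacobson" using \<open>y \<notin> jacobson\<close> y by (auto simp: K_def)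
  then have "K \<in> F" using K nil_left_ideal_subset_jacobson[OF K] by (auto simp: F_def)
  moreover have "left_ideal I R" if "I \<in> F" for I using that by (simp add: F_def)
  ultimately obtain L where L: "L \<in> F" "\<And>I. I \<in> F \<Longrightarrow> I \<subseteq> L \<Longrightarrow> I = L"
    using minimal_left_ideal by blast
  then obtain a where a: "a \<in> L" "\<not> nilpotent_elem R a" and LK: "left_ideal L R" "L \<subseteq> K"
    by (auto simp: F_def)
  note LD = left_idealD[OF LK(1)]
  have ac: "a \<in> carrier R" using a LD by blast
  have aa_pow: "(a \<otimes> a) [^] n = a [^] (2 * n)" for n :: nat
    using ac by (induction n) (auto simp: m_assoc)
  have "carrier R #> (a \<otimes> a) \<subseteq> L"
    using LD(4)[OF _ LD(4)[OF ac a(1)]] by (auto simp: mem_principal)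
  moreover have "a \<otimes> a \<in> carrier R #> (a \<otimes> a)"
    using ac by (auto simp: mem_principal intro!: bexI[of _ \<one>])
  moreover have "\<not> nilpotent_elem R (a \<otimes> a)"
    using a(2) by (auto simp: nilpotent_elem_def aa_pow)
  ultimately have "carrier R #> (a \<otimes> a) \<in> F"
    using left_ideal_principal[of "a \<otimes> a"] ac LK(2) by (auto simp: F_def)
  then have "carrier R #> (a \<otimes> a) = L"
    using L(2) \<open>carrier R #> (a \<otimes> a) \<subseteq> L\<close> by blast
  then obtain c where c: "c \<in> carrier R" "a = c \<otimes> (a \<otimes> a)"
    using a(1) by (auto simp: mem_principal)
  \<comment> \<open>On \<open>a\<close> the element \<open>q\<close> acts as an identity, so \<open>q - q\<^sup>2\<close> kills \<open>a\<close> and lies in a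
      proper left ideal of \<open>L\<close>, which is nil.\<close>
  define q where "q = c \<otimes> a"
  have q: "q \<in> L" "q \<in> carrier R" using LD a c by (auto simp: q_def)
  have qa: "q \<otimes> a = a" using c ac by (simp add: q_def m_assoc)
  have a0: "a \<noteq> \<zero>"
    using a(2) ac unfolding nilpotent_elem_def by (metis nat_pow_0 nat_pow_Suc l_one)
  have "q [^] n \<otimes> a = a" for n :: nat
    using qa ac q(2) by (induction n) (auto simp: m_assoc)
  then have "\<not> nilpotent_elem R q"
    using a0 ac by (auto simp: nilpotent_elem_def) (metis l_null)
  then have q_notin: "q \<notin> jacobson" using jacobson_nil by blast
  define L' where "L' = {z \<in> L. z \<otimes> a = \<zero>}"
  have L': "left_ideal L' R"
    using LD ac by (intro left_idealI) (auto simp: L'_def l_distr m_assoc subset_iff)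
  have "L' \<noteq> L"
  proof -
    have "a \<otimes> a \<noteq> \<zero>" using a0 c r_null by metis
    then show ?thesis using a(1) by (auto simp: L'_def)
  qed
  then have "L' \<subseteq> jacobson"
    using L(2)[of L'] L' LK(2) by (intro nil_left_ideal_subset_jacobson[OF L']) (auto simp: F_def L'_def)
  moreover have "q \<ominus> q \<otimes> q \<in> L'"
    using LD(4,5) q ac qa by (auto simp: L'_def minus_eq l_distr l_minus m_assoc r_neg)
  ultimately have qq: "q \<ominus> q \<otimes> q \<in> jacobson" by blast
  have qK: "q \<in> carrier R #> x" "q \<otimes> x \<in> jacobson" using q LK(2) by (auto simp: K_def)
  have inJ: "u \<oplus> v \<in> jacobson" "u \<ominus> v \<in> jacobson" if "u \<in> jacobson" "v \<in> jacobson" for u v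
    using that J.a_closed J.a_inv_closed by (auto simp: minus_eq)
  have split: "u \<in> jacobson \<longleftrightarrow> v \<in> jacobson"
    if "u = v \<ominus> j" "j \<in> jacobson" "v \<in> carrier R" for u v j
  proof -
    have "v = u \<oplus> j" using that J.Icarr by (simp add: minus_eq a_assoc l_neg)
    then show ?thesis using that inJ by metis
  qed
  have qq_notin: "q \<otimes> q \<notin> jacobson"
    using split[of "q \<otimes> q" q "q \<ominus> q \<otimes> q"] qq q q_notin
    by (simp add: minus_eq minus_add a_ac r_neg2 r_neg1)
  have witness: "\<exists>g\<in>carrier R #> x. (\<forall>i<k. g \<otimes> (x [^] i \<otimes> q) \<in> jacobson)
      \<and> g \<otimes> (x [^] k \<otimes> q) \<notin> jacobson" for k :: nat
  proof (induction k)
    case 0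
    then show ?case using qK qq_notin q by auto
  next
    case (Suc k)
    then obtain g where g: "g \<in> carrier R #> x" "\<forall>i<k. g \<otimes> (x [^] i \<otimes> q) \<in> jacobson"
      "g \<otimes> (x [^] k \<otimes> q) \<notin> jacobson" by blast
    then have "g \<in> carrier R #> (x \<otimes> x)" using stable by blast
    then obtain r where r: "r \<in> carrier R" "g = r \<otimes> (x \<otimes> x)"
      unfolding mem_principal by blast
    define p where "p = r \<otimes> x"
    have p: "p \<in> carrier R #> x" "p \<in> carrier R" "g = p \<otimes> x"
      using r x by (auto simp: p_def mem_principal m_assoc)
    define g' where "g' = p \<ominus> p \<otimes> q"
    have g': "g' \<in> carrier R #> x" "g' \<in> carrier R"
      using p qK Rx(4,5) q by (auto simp: g'_def)
    have zero: "g' \<otimes> q \<in> jacobson"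
    proof -
      have "g' \<otimes> q = p \<otimes> (q \<ominus> q \<otimes> q)"
        using p q by (simp add: g'_def minus_eq l_distr r_distr l_minus r_minus m_assoc)
      then show ?thesis using qq p J.I_l_closed by simp
    qed
    have shift: "g' \<otimes> (x [^] Suc i \<otimes> q) \<in> jacobson \<longleftrightarrow> g \<otimes> (x [^] i \<otimes> q) \<in> jacobson" for i
    proof (rule split)
      have "g' \<otimes> (x [^] Suc i \<otimes> q) = g' \<otimes> x \<otimes> (x [^] i \<otimes> q)"
        using g' x q by (simp add: m_assoc pow_mult_left pow_mult_left_assoc)
      also have "g' \<otimes> x = g \<ominus> p \<otimes> (q \<otimes> x)"
        using p q x by (simp add: g'_def minus_eq l_distr l_minus m_assoc)
      also have "\<dots> \<otimes> (x [^] i \<otimes> q) = g \<otimes> (x [^] i \<otimes> q) \<ominus> p \<otimes> (q \<otimes> x) \<otimes> (x [^] i \<otimes> q)"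
        using p q x by (simp add: minus_eq l_distr l_minus)
      finally show "g' \<otimes> (x [^] Suc i \<otimes> q)
        = g \<otimes> (x [^] i \<otimes> q) \<ominus> p \<otimes> (q \<otimes> x) \<otimes> (x [^] i \<otimes> q)" .
      show "p \<otimes> (q \<otimes> x) \<otimes> (x [^] i \<otimes> q) \<in> jacobson"
        using J.I_r_closed[OF J.I_l_closed[OF qK(2) p(2)]] x q by simp
      show "g \<otimes> (x [^] i \<otimes> q) \<in> carrier R" using p q x by auto
    qed
    have "g' \<otimes> (x [^] i \<otimes> q) \<in> jacobson" if "i < Suc k" for i
      using that zero g(2) shift q by (cases i) (auto simp del: nat_pow_Suc)
    moreover have "g' \<otimes> (x [^] Suc k \<otimes> q) \<notin> jacobson"
      using shift g(3) by blast
    ultimately show ?case using g' by blast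
  qed
  define C where "C k = {y \<in> carrier R. \<forall>i<k. y \<otimes> (x [^] i \<otimes> q) \<in> jacobson}" for k :: nat
  have "left_ideal (C k) R" for k
    using x q by (intro left_idealI) (auto simp: C_def l_distr m_assoc inJ J.I_l_closed)
  moreover have "C (Suc k) \<subseteq> C k" for k by (auto simp: C_def)
  ultimately obtain k where "\<forall>n\<ge>k. C n = C k"
    using artinian[unfolded left_artinian_def, rule_format, of C] by blast
  then have "C (Suc k) = C k" by (meson le_SucI le_refl)
  moreover obtain g where "g \<in> carrier R #> x" "\<forall>i<k. g \<otimes> (x [^] i \<otimes> q) \<in> jacobson"
      "g \<otimes> (x [^] k \<otimes> q) \<notin> jacobson" using witness by blast
  ultimately show False using Rx(1) by (auto simp: C_def set_eq_iff)
qed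

text \<open>Choose \<open>b \<in> Rx\<close> with \<open>b x\<^sup>2 = x\<close>. Injectivity modulo \<open>J\<close>, applied to the elements
  \<open>xbx - x\<close> and then \<open>x\<^sup>2 b - x\<close> of \<open>Rx\<close>, gives \<open>x - x\<^sup>2 b \<in> J\<close>. Hence
  \<open>x\<^sup>m\<^sup>+\<^sup>1\<close> is a right multiple of its square for some \<open>m\<close>, and any
  \<open>y = u x\<^sup>m\<^sup>+\<^sup>1\<close> with \<open>yx = 0\<close> vanishes; all elements of \<open>Rx\<close> have this form.\<close>
lemma right_mult_kernel_zero:
  assumes x: "x \<in> carrier R" and stable: "carrier R #> x \<subseteq> carrier R #> (x \<otimes> x)"
    and y: "y \<in> carrier R #> x" "y \<otimes> x = \<zero>"
  shows "y = \<zero>"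
proof -
  interpret J: ideal jacobson R by (rule jacobson_ideal)
  note Rx = left_idealD[OF left_ideal_principal[OF x]]
  have xRx: "x \<in> carrier R #> x"
    using x by (auto simp: mem_principal intro!: bexI[of _ \<one>])
  then have "x \<in> carrier R #> (x \<otimes> x)" using stable by blast
  then obtain r where r: "r \<in> carrier R" "x = r \<otimes> (x \<otimes> x)"
    unfolding mem_principal by blast
  \<comment> \<open>Substituting \<open>x = r x\<^sup>2\<close> into itself puts the coefficient into \<open>Rx\<close>.\<close>
  define b where "b = r \<otimes> r \<otimes> x"
  have b: "b \<in> carrier R #> x" "b \<in> carrier R"
    using r x by (auto simp: b_def mem_principal)
  have "b \<otimes> (x \<otimes> x) = r \<otimes> ((r \<otimes> (x \<otimes> x)) \<otimes> x)"
    using r(1) x by (simp add: b_def m_assoc)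
  then have bxx: "b \<otimes> (x \<otimes> x) = x" using r by metis
  have xbx: "x \<otimes> b \<otimes> x \<ominus> x \<in> jacobson"
  proof (rule right_mult_kernel_in_jacobson[OF x stable])
    show "x \<otimes> b \<otimes> x \<ominus> x \<in> carrier R #> x"
      using xRx b x by (intro Rx(5) Rx(4)) auto
    have "(x \<otimes> b \<otimes> x \<ominus> x) \<otimes> x = x \<otimes> (b \<otimes> (x \<otimes> x)) \<ominus> x \<otimes> x"
      using x b by (simp add: minus_eq l_distr l_minus m_assoc)
    then show "(x \<otimes> b \<otimes> x \<ominus> x) \<otimes> x \<in> jacobson"
      using bxx x by (simp add: minus_eq r_neg)
  qed
  have "x \<otimes> x \<otimes> b \<ominus> x \<in> jacobson"
  proof (rule right_mult_kernel_in_jacobson[OF x stable])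
    show "x \<otimes> x \<otimes> b \<ominus> x \<in> carrier R #> x"
      using xRx b x by (intro Rx(5) Rx(4)) auto
    have "(x \<otimes> x \<otimes> b \<ominus> x) \<otimes> x = x \<otimes> (x \<otimes> b \<otimes> x \<ominus> x)"
      using x b by (simp add: minus_eq l_distr r_distr l_minus r_minus m_assoc)
    then show "(x \<otimes> x \<otimes> b \<ominus> x) \<otimes> x \<in> jacobson"
      using xbx x J.I_l_closed by simp
  qed
  then have "\<ominus> (x \<otimes> x \<otimes> b \<ominus> x) \<in> jacobson" by (rule J.a_inv_closed)
  then have xxb: "x \<ominus> x \<otimes> x \<otimes> b \<in> jacobson"
    using x b by (simp add: minus_eq minus_add a_comm)
  obtain m where m: "ideal_power jacobson m = {\<zero>}"
    using nil_ideal_nilpotent[OF jacobson_ideal jacobson_nil] by blast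
  obtain t where t: "t \<in> carrier R" "x [^] m = x [^] (m + Suc m) \<otimes> t"
    using power_mem_right_multiples[OF jacobson_ideal m x b(2) xxb] by blast
  have "y \<in> carrier R #> (x [^] Suc k)" for k
  proof (induction k)
    case 0
    then show ?case using y x by simp
  next
    case (Suc k)
    then obtain u where u: "u \<in> carrier R" "y = (u \<otimes> x) \<otimes> x [^] k"
      using x by (auto simp: mem_principal m_assoc pow_mult_left)
    have "u \<otimes> x \<in> carrier R #> x" using u(1) by (auto simp: mem_principal)
    then have "u \<otimes> x \<in> carrier R #> (x \<otimes> x)" using stable by blast
    then obtain v where v: "v \<in> carrier R" "u \<otimes> x = v \<otimes> (x \<otimes> x)"
      unfolding mem_principal by blast
    have "y = v \<otimes> x [^] Suc (Suc k)"
      using u(2) unfolding v(2) using v(1) x 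
      by (simp add: m_assoc pow_mult_left pow_mult_left_assoc)
    then show ?case using v(1) by (auto simp: mem_principal)
  qed
  then obtain u where u: "u \<in> carrier R" "y = u \<otimes> x [^] Suc m"
    by (auto simp: mem_principal simp del: nat_pow_Suc)
  have "x [^] Suc m = x \<otimes> x [^] m" using x by (simp add: pow_mult_left)
  also have "\<dots> = x [^] Suc m \<otimes> x [^] Suc m \<otimes> t"
    by (subst t(2)) (use x t(1) in \<open>simp add: nat_pow_mult[symmetric] m_assoc pow_mult_left pow_mult_left_assoc\<close>)
  also have "\<dots> = x [^] Suc m \<otimes> (x \<otimes> (x [^] m \<otimes> t))"
    using x t(1) by (simp add: m_assoc pow_mult_left pow_mult_left_assoc)
  finally have eq: "x [^] Suc m = x [^] Suc m \<otimes> (x \<otimes> (x [^] m \<otimes> t))" .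
  have "y = u \<otimes> (x [^] Suc m \<otimes> (x \<otimes> (x [^] m \<otimes> t)))"
    using u(2) eq by metis
  also have "\<dots> = y \<otimes> x \<otimes> (x [^] m \<otimes> t)"
    unfolding u(2) using u(1) x t(1) by (simp add: m_assoc)
  also have "\<dots> = \<zero>" using y(2) x t(1) by simp
  finally show ?thesis .
qed

end

section \<open>Left localizations as rings of fractions\<close>

context ring
begin

lemma Den_l_common_denominator:
  assumes S: "S \<in> Den_l R" and r: "r \<in> carrier R" and t: "t \<in> S"
  shows "\<exists>c\<in>S. \<exists>d\<in>carrier R. c \<otimes> r = d \<otimes> t"
proof -
  have "(S #> r) \<inter> (carrier R #> t) \<noteq> {}"
    using S r t by (simp add: Den_l_def left_ore_set_def)
  then show ?thesis by (auto simp: r_coset_def)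
qed

text \<open>The isomorphism sends \<open>v\<close> to the set of all pairs \<open>(s, r)\<close> with
  \<open>\<phi>(s) v = \<phi>(r)\<close>. Two pairs are equivalent exactly if they lie in the same such set: by the Ore condition they
  have a common denominator, and numerators with the same image under \<open>\<phi>\<close> become equal after multiplication by a
  further denominator, as the kernel is contained in \<open>ass S\<close>. Products and sums of fractions are unions over all
  choices of representatives and common denominators; the Ore condition makes these unions nonempty, and all their members
  are the same class.\<close>
lemma left_localization_iso:
  fixes Q (structure)
  assumes S: "S \<in> Den_l R" and Q: "ring Q" and \<phi>: "\<phi> \<in> ring_hom R Q"
    and units: "\<And>s. s \<in> S \<Longrightarrow> \<phi> s \<in> Units Q"
    and kernel: "\<And>r. r \<in> carrier R \<Longrightarrow> \<phi> r = \<zero>\<^bsub>Q\<^esub> \<Longrightarrow> r \<in> ass R S"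
    and fractions: "\<And>q. q \<in> carrier Q \<Longrightarrow> \<exists>s\<in>S. \<exists>r\<in>carrier R. \<phi> s \<otimes>\<^bsub>Q\<^esub> q = \<phi> r"
  shows "Q \<simeq> left_localization R S"
proof -
  interpret Q: ring Q by (rule Q)
  interpret hom: ring_hom_ring R Q \<phi>
    using ring_axioms Q \<phi> by (simp add: ring_hom_ringI2)
  have SR: "S \<subseteq> carrier R" and one_S: "\<one> \<in> S"
    and S_mult: "\<And>s t. s \<in> S \<Longrightarrow> t \<in> S \<Longrightarrow> s \<otimes> t \<in> S"
    using S by (auto simp: Den_l_def left_ore_set_def multiplicative_set_def)
  have \<phi>_cancel: "x = y"
    if "s \<in> S" "\<phi> s \<otimes>\<^bsub>Q\<^esub> x = \<phi> s \<otimes>\<^bsub>Q\<^esub> y" "x \<in> carrier Q" "y \<in> carrier Q" for s x y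
    using that units Q.Units_l_cancel by blast
  have divide: "\<exists>v\<in>carrier Q. \<phi> s \<otimes>\<^bsub>Q\<^esub> v = \<phi> r" if "s \<in> S" "r \<in> carrier R" for s r
    using units[OF that(1)] that(2)
    by (intro bexI[of _ "inv\<^bsub>Q\<^esub> \<phi> s \<otimes>\<^bsub>Q\<^esub> \<phi> r"]) (simp_all add: Q.m_assoc[symmetric] Q.Units_closed)
  define fib where "fib v = {(s, r) \<in> S \<times> carrier R. \<phi> s \<otimes>\<^bsub>Q\<^esub> v = \<phi> r}" for v
  have frac: "frac R S s r = fib v"
    if sr: "(s, r) \<in> fib v" and v: "v \<in> carrier Q" for s r v
  proof -
    have s: "s \<in> S" "s \<in> carrier R" and r: "r \<in> carrier R" and sv: "\<phi> s \<otimes>\<^bsub>Q\<^esub> v = \<phi> r"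
      using sr SR by (auto simp: fib_def)
    have "((s, r), (t, q)) \<in> frac_rel R S \<longleftrightarrow> (t, q) \<in> fib v" for t q
    proof
      assume "((s, r), (t, q)) \<in> frac_rel R S"
      then obtain c d where t: "t \<in> S" and q: "q \<in> carrier R"
        and cd: "c \<in> carrier R" "d \<in> carrier R" "c \<otimes> s = d \<otimes> t" "c \<otimes> s \<in> S" "c \<otimes> r = d \<otimes> q"
        by (auto simp: frac_rel_def)
      have tc: "t \<in> carrier R" using t SR by blast
      obtain w where w: "w \<in> carrier Q" "\<phi> t \<otimes>\<^bsub>Q\<^esub> w = \<phi> q"
        using divide[OF t q] by blast
      have "\<phi> (c \<otimes> s) \<otimes>\<^bsub>Q\<^esub> v = \<phi> c \<otimes>\<^bsub>Q\<^esub> (\<phi> s \<otimes>\<^bsub>Q\<^esub> v)"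
        using cd(1) s v by (simp add: Q.m_assoc)
      also have "\<dots> = \<phi> (d \<otimes> q)" unfolding sv using cd r by (metis hom.hom_mult)
      also have "\<dots> = \<phi> d \<otimes>\<^bsub>Q\<^esub> (\<phi> t \<otimes>\<^bsub>Q\<^esub> w)" using cd q w by simp
      also have "\<dots> = \<phi> (c \<otimes> s) \<otimes>\<^bsub>Q\<^esub> w"
        unfolding cd(3) using cd(2) tc w by (simp add: Q.m_assoc)
      finally have "v = w" using \<phi>_cancel[OF cd(4)] v w by blast
      then show "(t, q) \<in> fib v" using t q w by (simp add: fib_def)
    next
      assume "(t, q) \<in> fib v"
      then have t: "t \<in> S" "t \<in> carrier R" and q: "q \<in> carrier R" and tv: "\<phi> t \<otimes>\<^bsub>Q\<^esub> v = \<phi> q"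
        using SR by (auto simp: fib_def)
      obtain c d where cd: "c \<in> S" "d \<in> carrier R" "c \<otimes> s = d \<otimes> t"
        using Den_l_common_denominator[OF S s(2) t(1)] by blast
      have c: "c \<in> carrier R" using cd SR by blast
      have "\<phi> (c \<otimes> r) = \<phi> (c \<otimes> s) \<otimes>\<^bsub>Q\<^esub> v"
        using c s r v by (simp add: sv[symmetric] Q.m_assoc)
      also have "\<dots> = \<phi> (d \<otimes> q)"
        unfolding cd(3) using cd(2) t q v by (simp add: tv[symmetric] Q.m_assoc)
      finally have "\<phi> (c \<otimes> r \<ominus> d \<otimes> q) = \<zero>\<^bsub>Q\<^esub>"
        using c cd(2) r q by (simp add: minus_eq Q.r_neg del: hom.hom_mult)
      then obtain u where u: "u \<in> S" "u \<otimes> (c \<otimes> r \<ominus> d \<otimes> q) = \<zero>"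
        using kernel[of "c \<otimes> r \<ominus> d \<otimes> q"] c cd(2) r q by (auto simp: ass_def)
      have uc: "u \<in> carrier R" using u SR by blast
      have "u \<otimes> (c \<otimes> r) = u \<otimes> (d \<otimes> q)"
      proof -
        have "u \<otimes> (c \<otimes> r) \<oplus> \<ominus> (u \<otimes> (d \<otimes> q)) = \<zero>"
          using u(2) uc c cd(2) r q by (simp add: minus_eq r_distr r_minus)
        then show ?thesis using uc c cd(2) r q
          by (metis a_inv_closed m_closed minus_equality minus_minus)
      qed
      then have "(u \<otimes> c) \<otimes> s = (u \<otimes> d) \<otimes> t" "(u \<otimes> c) \<otimes> r = (u \<otimes> d) \<otimes> q"
        "(u \<otimes> c) \<otimes> s \<in> S" "u \<otimes> c \<in> carrier R" "u \<otimes> d \<in> carrier R"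
        using uc c cd s(2) t(2) r q S_mult[OF u(1) S_mult[OF cd(1) s(1)]]
        by (simp_all add: m_assoc)
      then show "((s, r), (t, q)) \<in> frac_rel R S"
        using s(1) t(1) r q unfolding frac_rel_def by blast
    qed
    then show ?thesis by (auto simp: frac_def)
  qed
  have fib_nonempty: "\<exists>s r. (s, r) \<in> fib v" if "v \<in> carrier Q" for v
    using fractions[OF that] by (auto simp: fib_def)
  have fibD: "s \<in> S" "s \<in> carrier R" "r \<in> carrier R" "\<phi> s \<otimes>\<^bsub>Q\<^esub> v = \<phi> r"
    if "(s, r) \<in> fib v" for s r v
    using that SR by (auto simp: fib_def)
  have fib_carrier: "fib v \<in> carrier (left_localization R S)" if v: "v \<in> carrier Q" for v
  proof -
    obtain s r where sr: "(s, r) \<in> fib v" using v fib_nonempty by blast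
    then have "fib v = frac_rel R S `` {(s, r)}" using frac[OF sr v] by (simp add: frac_def)
    then show ?thesis
      using fibD[OF sr] by (auto simp: left_localization_def intro!: quotientI)
  qed
  have fib_eqD: "v = w" if "p \<in> fib v" "p \<in> fib w" "v \<in> carrier Q" "w \<in> carrier Q" for p v w
    using that \<phi>_cancel by (cases p) (auto simp: fib_def)
  have fib_mult: "(c \<otimes> s, d \<otimes> q) \<in> fib (v \<otimes>\<^bsub>Q\<^esub> w)"
    if vw: "v \<in> carrier Q" "w \<in> carrier Q" and sr: "(s, r) \<in> fib v" and tq: "(t, q) \<in> fib w"
      and cd: "c \<in> S" "d \<in> carrier R" "c \<otimes> r = d \<otimes> t" for v w s r t q c d
  proof -
    note D = fibD[OF sr] fibD[OF tq]
    have c: "c \<in> carrier R" using cd SR by blast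
    have "\<phi> (c \<otimes> s) \<otimes>\<^bsub>Q\<^esub> (v \<otimes>\<^bsub>Q\<^esub> w) = \<phi> c \<otimes>\<^bsub>Q\<^esub> (\<phi> s \<otimes>\<^bsub>Q\<^esub> v) \<otimes>\<^bsub>Q\<^esub> w"
      using c D(1-3) vw by (simp add: Q.m_assoc)
    also have "\<dots> = \<phi> (c \<otimes> r) \<otimes>\<^bsub>Q\<^esub> w" using c D(3,4) by simp
    also have "\<dots> = \<phi> d \<otimes>\<^bsub>Q\<^esub> (\<phi> t \<otimes>\<^bsub>Q\<^esub> w)"
      unfolding cd(3) using cd(2) D(6) vw by (simp add: Q.m_assoc)
    also have "\<dots> = \<phi> (d \<otimes> q)" using cd(2) D(7,8) by simp
    finally show ?thesis using cd c D S_mult by (auto simp: fib_def)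
  qed
  have fib_add: "(c \<otimes> s, c \<otimes> r \<oplus> d \<otimes> q) \<in> fib (v \<oplus>\<^bsub>Q\<^esub> w)"
    if vw: "v \<in> carrier Q" "w \<in> carrier Q" and sr: "(s, r) \<in> fib v" and tq: "(t, q) \<in> fib w"
      and cd: "c \<in> carrier R" "d \<in> carrier R" "c \<otimes> s = d \<otimes> t" "c \<otimes> s \<in> S" for v w s r t q c d
  proof -
    note D = fibD[OF sr] fibD[OF tq]
    have "\<phi> (c \<otimes> s) \<otimes>\<^bsub>Q\<^esub> v = \<phi> (c \<otimes> r)"
      using cd(1) D(2-4) vw by (simp add: Q.m_assoc)
    moreover have "\<phi> (c \<otimes> s) \<otimes>\<^bsub>Q\<^esub> w = \<phi> (d \<otimes> q)"
      unfolding cd(3) using cd(2) D(6-8) vw by (simp add: Q.m_assoc)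
    ultimately have "\<phi> (c \<otimes> s) \<otimes>\<^bsub>Q\<^esub> (v \<oplus>\<^bsub>Q\<^esub> w) = \<phi> (c \<otimes> r) \<oplus>\<^bsub>Q\<^esub> \<phi> (d \<otimes> q)"
      using cd(1) D(2) vw by (simp add: Q.r_distr del: hom.hom_mult)
    then show ?thesis using cd D by (auto simp: fib_def simp del: hom.hom_mult)
  qed
  have "fib \<in> ring_iso Q (left_localization R S)"
  proof (rule ring_iso_memI)
    show "fib v \<in> carrier (left_localization R S)" if "v \<in> carrier Q" for v
      using that by (rule fib_carrier)
  next
    fix v w assume v: "v \<in> carrier Q" and w: "w \<in> carrier Q"
    obtain s r t q where st: "(s, r) \<in> fib v" "(t, q) \<in> fib w"
      using fib_nonempty v w by meson
    have fracs: "frac R S (c \<otimes> s) (d \<otimes> q) = fib (v \<otimes>\<^bsub>Q\<^esub> w)"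
      if "(s, r) \<in> fib v" "(t, q) \<in> fib w" "c \<in> S" "d \<in> carrier R" "c \<otimes> r = d \<otimes> t"
      for s r t q c d
      using frac[OF fib_mult[OF v w that]] v w by simp
    obtain c d where cd: "c \<in> S" "d \<in> carrier R" "c \<otimes> r = d \<otimes> t"
      using Den_l_common_denominator[OF S fibD(3)[OF st(1)] fibD(1)[OF st(2)]] by blast
    let ?M = "{frac R S (c \<otimes> s) (d \<otimes> q) | s r t q c d. (s, r) \<in> fib v \<and> (t, q) \<in> fib w \<and>
        c \<in> S \<and> d \<in> carrier R \<and> c \<otimes> r = d \<otimes> t}"
    have "X = fib (v \<otimes>\<^bsub>Q\<^esub> w)" if "X \<in> ?M" for X
      using that fracs by blast
    moreover have "frac R S (c \<otimes> s) (d \<otimes> q) \<in> ?M"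
      using cd st by blast
    ultimately have "\<Union>?M = fib (v \<otimes>\<^bsub>Q\<^esub> w)" by blast
    then show "fib (v \<otimes>\<^bsub>Q\<^esub> w) = fib v \<otimes>\<^bsub>left_localization R S\<^esub> fib w"
      by (simp add: left_localization_def)
    have fracs: "frac R S (c \<otimes> s) (c \<otimes> r \<oplus> d \<otimes> q) = fib (v \<oplus>\<^bsub>Q\<^esub> w)"
      if "(s, r) \<in> fib v" "(t, q) \<in> fib w" "c \<in> carrier R" "d \<in> carrier R"
        "c \<otimes> s = d \<otimes> t" "c \<otimes> s \<in> S" for s r t q c d
      using frac[OF fib_add[OF v w that]] v w by simp
    obtain c d where "c \<in> S" "d \<in> carrier R" "c \<otimes> s = d \<otimes> t"
      using Den_l_common_denominator[OF S fibD(2)[OF st(1)] fibD(1)[OF st(2)]] by blast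
    then have cd: "c \<in> carrier R" "d \<in> carrier R" "c \<otimes> s = d \<otimes> t" "c \<otimes> s \<in> S"
      using SR S_mult[OF \<open>c \<in> S\<close> fibD(1)[OF st(1)]] by blast+
    let ?A = "{frac R S (c \<otimes> s) (c \<otimes> r \<oplus> d \<otimes> q) | s r t q c d. (s, r) \<in> fib v \<and> (t, q) \<in> fib w \<and>
        c \<in> carrier R \<and> d \<in> carrier R \<and> c \<otimes> s = d \<otimes> t \<and> c \<otimes> s \<in> S}"
    have "X = fib (v \<oplus>\<^bsub>Q\<^esub> w)" if "X \<in> ?A" for X
      using that fracs by blast
    moreover have "frac R S (c \<otimes> s) (c \<otimes> r \<oplus> d \<otimes> q) \<in> ?A"
      using cd st by blast
    ultimately have "\<Union>?A = fib (v \<oplus>\<^bsub>Q\<^esub> w)" by blast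
    then show "fib (v \<oplus>\<^bsub>Q\<^esub> w) = fib v \<oplus>\<^bsub>left_localization R S\<^esub> fib w"
      by (simp add: left_localization_def)
  next
    have "(\<one>, \<one>) \<in> fib \<one>\<^bsub>Q\<^esub>" using one_S by (simp add: fib_def)
    then show "fib \<one>\<^bsub>Q\<^esub> = \<one>\<^bsub>left_localization R S\<^esub>"
      using frac by (simp add: left_localization_def)
  next
    have "inj_on fib (carrier Q)"
      using fib_nonempty fib_eqD by (auto intro!: inj_onI) (metis)
    moreover have "A \<in> fib ` carrier Q" if "A \<in> carrier (left_localization R S)" for A
    proof -
      have "\<exists>s\<in>S. \<exists>r\<in>carrier R. A = frac R S s r"
      proof -
        have "A \<in> (S \<times> carrier R) // frac_rel R S"
          using that by (simp add: left_localization_def)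
        then obtain p where "p \<in> S \<times> carrier R" "A = frac_rel R S `` {p}"
          by (rule quotientE)
        then show ?thesis using that by (cases p) (auto simp: frac_def)
      qed
      then obtain s r where sr: "s \<in> S" "r \<in> carrier R" "A = frac R S s r" by blast
      obtain v where "v \<in> carrier Q" "\<phi> s \<otimes>\<^bsub>Q\<^esub> v = \<phi> r"
        using divide[OF sr(1,2)] by blast
      then have "v \<in> carrier Q" "(s, r) \<in> fib v" using sr by (auto simp: fib_def)
      then show ?thesis using frac sr(3) by blast
    qed
    ultimately show "bij_betw fib (carrier Q) (carrier (left_localization R S))"
      using fib_carrier by (auto simp: bij_betw_def)
  qed
  then show ?thesis by (auto simp: is_ring_iso_def)
qed

end

section \<open>The idempotent associated with an element\<close>

context left_artinian_ring
begin

context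
  fixes s
  assumes s: "s \<in> carrier R"
begin

lemma stab_index_stable:
  assumes "i \<ge> stab_index R s"
  shows "carrier R #> (s [^] stab_index R s) = carrier R #> (s [^] i)"
  using LeastI_ex[OF principal_powers_stabilize[OF s]] assms
  unfolding stab_index_def by blast

text \<open>Injectivity of right multiplication by \<open>s\<^sup>n\<^sup>+\<^sup>1\<close>, where the image is stable, implies that of
  \<open>s\<close> itself; the exponent \<open>n + 1\<close> covers the case \<open>n = 0\<close>.\<close>
lemma right_mult_power_inj:
  assumes y: "y \<in> carrier R #> (s [^] stab_index R s)" and z: "z \<in> carrier R #> (s [^] stab_index R s)"
    and yz: "y \<otimes> s [^] (i::nat) = z \<otimes> s [^] i"
  shows "y = z"
proof -
  let ?n = "stab_index R s"
  note Rx = left_idealD[OF left_ideal_principal[of "s [^] ?n"], OF nat_pow_closed[OF s]]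
  define x where "x = s [^] Suc ?n"
  have x: "x \<in> carrier R" using s by (simp add: x_def)
  have xx: "x \<otimes> x = s [^] (Suc ?n + Suc ?n)"
    unfolding x_def using s by (rule nat_pow_mult)
  have Rx_eq: "carrier R #> x = carrier R #> (s [^] ?n)"
    unfolding x_def by (rule stab_index_stable[symmetric]) simp
  have stable: "carrier R #> x \<subseteq> carrier R #> (x \<otimes> x)"
    unfolding Rx_eq xx by (subst stab_index_stable[symmetric]) auto
  have kernel: "y = \<zero>" if "y \<in> carrier R #> (s [^] ?n)" "y \<otimes> s = \<zero>" for y
  proof (rule right_mult_kernel_zero[OF x stable])
    show "y \<in> carrier R #> x" using that Rx_eq by simp
    have "y \<in> carrier R" using that Rx(1) by blast
    then have "y \<otimes> x = (y \<otimes> s) \<otimes> s [^] ?n"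
      using s by (simp add: x_def m_assoc pow_mult_left[symmetric])
    then show "y \<otimes> x = \<zero>" using that s by simp
  qed
  have w: "y \<ominus> z \<in> carrier R #> (s [^] ?n)" "y \<ominus> z \<in> carrier R"
    using Rx(1) Rx(5)[OF y z] by blast+
  have yc: "y \<in> carrier R" and zc: "z \<in> carrier R" using y z Rx(1) by blast+
  have "y \<ominus> z = \<zero>" if "(y \<ominus> z) \<otimes> s [^] i = \<zero>"
    using that
  proof (induction i)
    case 0
    then show ?case using w(2) by simp
  next
    case (Suc i)
    from w(1) obtain r where r: "r \<in> carrier R" "y \<ominus> z = r \<otimes> s [^] ?n"
      by (auto simp: mem_principal)
    have "(y \<ominus> z) \<otimes> s [^] i = (r \<otimes> s [^] i) \<otimes> s [^] ?n"
      unfolding r(2) using r(1) s by (simp add: m_assoc nat_pow_mult add.commute)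
    then have "(y \<ominus> z) \<otimes> s [^] i \<in> carrier R #> (s [^] ?n)"
      using r(1) s by (auto simp: mem_principal)
    moreover have "(y \<ominus> z) \<otimes> s [^] i \<otimes> s = \<zero>"
      using Suc.prems w(2) s by (simp add: m_assoc)
    ultimately show ?case using kernel Suc.IH by blast
  qed
  moreover have "(y \<ominus> z) \<otimes> s [^] i = \<zero>"
    using yz yc zc s by (simp add: minus_eq l_distr l_minus r_neg)
  ultimately show ?thesis using yc zc by (simp add: minus_eq_zero_iff)
qed

text \<open>The conditions that define \<open>e\<close> say that \<open>e \<in> Rs\<^sup>n\<close> and \<open>e s\<^sup>n = s\<^sup>n\<close>. If
  \<open>s\<^sup>n = r s\<^sup>2\<^sup>n\<close> then \<open>r s\<^sup>n\<close> is such an element, and by injectivity it is the only one.\<close>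
lemma assoc_idem:
  shows assoc_idem_mem: "assoc_idem R s \<in> carrier R #> (s [^] stab_index R s)"
    and assoc_idem_unit: "assoc_idem R s \<otimes> s [^] stab_index R s = s [^] stab_index R s"
proof -
  let ?n = "stab_index R s"
  let ?x = "s [^] ?n"
  have x: "?x \<in> carrier R" using s by simp
  note Rx = left_idealD[OF left_ideal_principal[OF x]]
  let ?P = "\<lambda>e. e \<in> carrier R #> ?x \<and> (\<exists>e' \<in> right_mult_ker R ?x. \<one> = e \<oplus> e')"
  have P_iff: "?P e \<longleftrightarrow> e \<in> carrier R #> ?x \<and> e \<otimes> ?x = ?x" for e
  proof
    assume "?P e"
    then obtain e' where e: "e \<in> carrier R #> ?x" "e \<in> carrier R" "e' \<in> carrier R"
      "e' \<otimes> ?x = \<zero>" "\<one> = e \<oplus> e'"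
      using Rx(1) by (auto simp: right_mult_ker_def)
    have "?x = (e \<oplus> e') \<otimes> ?x" using x e(5)[symmetric] by simp
    also have "\<dots> = e \<otimes> ?x" using e(2-4) x by (simp add: l_distr)
    finally show "e \<in> carrier R #> ?x \<and> e \<otimes> ?x = ?x" using e by simp
  next
    assume e: "e \<in> carrier R #> ?x \<and> e \<otimes> ?x = ?x"
    then have c: "e \<in> carrier R" using Rx(1) by blast
    have "\<one> \<ominus> e \<in> right_mult_ker R ?x"
      using c e x by (simp add: right_mult_ker_def minus_eq l_distr l_minus r_neg)
    moreover have "\<one> = e \<oplus> (\<one> \<ominus> e)" using c by (simp add: minus_eq a_lcomm[of e \<one>] r_neg)
    ultimately show "?P e" using e by blast
  qed
  have "?x \<in> carrier R #> ?x" using x by (auto simp: mem_principal intro!: bexI[of _ \<one>])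
  then have "?x \<in> carrier R #> (s [^] (?n + ?n))" using stab_index_stable[of "?n + ?n"] by simp
  then obtain r where r: "r \<in> carrier R" "?x = r \<otimes> s [^] (?n + ?n)"
    unfolding mem_principal by blast
  have "r \<otimes> ?x \<otimes> ?x = ?x"
    using r(1) x s by (simp add: m_assoc nat_pow_mult r(2)[symmetric])
  then have ex: "?P (r \<otimes> ?x)" unfolding P_iff using r(1) by (auto simp: mem_principal)
  have unique: "e = r \<otimes> ?x" if "?P e" for e
    using that ex right_mult_power_inj unfolding P_iff by metis
  have "?P (assoc_idem R s)"
    unfolding assoc_idem_def by (rule theI[of ?P, OF ex unique])
  then show "assoc_idem R s \<in> carrier R #> ?x" "assoc_idem R s \<otimes> ?x = ?x"
    unfolding P_iff by auto
qed

end

end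

text \<open>What the theorem needs of \<open>e\<close>: it is the identity of a corner \<open>eRe\<close> in which \<open>s\<close> becomes
  invertible, and the complementary part of \<open>s\<close> is nilpotent. This describes \<open>e\<close> for any non-nilpotent
  strongly \<open>\<pi>\<close>-regular \<open>s\<close>, without reference to chain conditions.\<close>
locale fitting_idempotent = ring R for R (structure) +
  fixes s e and n :: nat
  assumes s_closed: "s \<in> carrier R" and e_closed: "e \<in> carrier R"
    and pow_e: "s [^] n \<otimes> e = s [^] n"
    and corner_inverse: "\<And>i::nat. \<exists>v\<in>carrier R. v \<otimes> s [^] i = e \<and> s [^] i \<otimes> v = e"
    and not_nilpotent: "\<not> nilpotent_elem R s"

text \<open>All equations here hold between elements of \<open>Rs\<^sup>n\<close> and become obvious after multiplication on the right by a
  power of \<open>s\<close>.\<close>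
lemma (in left_artinian_ring) assoc_idem_fitting:
  assumes s: "s \<in> carrier R" and "\<not> nilpotent_elem R s"
  shows "fitting_idempotent R s (assoc_idem R s) (stab_index R s)"
proof -
  let ?n = "stab_index R s" and ?e = "assoc_idem R s"
  note Rx = left_idealD[OF left_ideal_principal[of "s [^] ?n"], OF nat_pow_closed[OF s]]
  note inj = right_mult_power_inj[OF s]
  have xRx: "s [^] ?n \<in> carrier R #> (s [^] ?n)"
    using s by (auto simp: mem_principal intro!: bexI[of _ \<one>])
  have e: "?e \<in> carrier R #> (s [^] ?n)" "?e \<in> carrier R" and es: "?e \<otimes> s [^] ?n = s [^] ?n"
    using assoc_idem[OF s] Rx(1) by auto
  have pow_e: "s [^] ?n \<otimes> ?e = s [^] ?n"
  proof (rule inj)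
    show "s [^] ?n \<otimes> ?e \<in> carrier R #> (s [^] ?n)" using Rx(4) e s by blast
    show "s [^] ?n \<otimes> ?e \<otimes> s [^] ?n = s [^] ?n \<otimes> s [^] ?n"
      using e s es by (simp add: m_assoc)
  qed (rule xRx)
  have comm: "?e \<otimes> s [^] i = s [^] i \<otimes> ?e" for i :: nat
  proof (rule inj)
    obtain r where "r \<in> carrier R" "?e = r \<otimes> s [^] ?n"
      using e(1) by (auto simp: mem_principal)
    then have "?e \<otimes> s [^] i = (r \<otimes> s [^] i) \<otimes> s [^] ?n"
      using s by (simp add: m_assoc nat_pow_mult add.commute)
    then show "?e \<otimes> s [^] i \<in> carrier R #> (s [^] ?n)"
      using \<open>r \<in> carrier R\<close> s by (auto simp: mem_principal)
    show "s [^] i \<otimes> ?e \<in> carrier R #> (s [^] ?n)" using Rx(4) e s by blast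
    have "?e \<otimes> s [^] i \<otimes> s [^] ?n = ?e \<otimes> s [^] ?n \<otimes> s [^] i"
      using e s by (simp add: m_assoc nat_pow_mult add.commute)
    also have "\<dots> = s [^] i \<otimes> ?e \<otimes> s [^] ?n"
      using e s by (simp add: es m_assoc) (simp add: nat_pow_mult add.commute)
    finally show "?e \<otimes> s [^] i \<otimes> s [^] ?n = s [^] i \<otimes> ?e \<otimes> s [^] ?n" .
  qed
  have "\<exists>v\<in>carrier R. v \<otimes> s [^] i = ?e \<and> s [^] i \<otimes> v = ?e" for i :: nat
  proof -
    have "?e \<in> carrier R #> (s [^] (?n + i))"
      using e(1) stab_index_stable[OF s, of "?n + i"] by simp
    then obtain r where r: "r \<in> carrier R" "?e = r \<otimes> s [^] (?n + i)"
      unfolding mem_principal by blast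
    define v where "v = r \<otimes> s [^] ?n"
    have v: "v \<in> carrier R" "v \<in> carrier R #> (s [^] ?n)"
      using r s by (auto simp: v_def mem_principal)
    have vs: "v \<otimes> s [^] i = ?e"
      using r s by (simp add: v_def m_assoc nat_pow_mult)
    have "s [^] i \<otimes> v = ?e"
    proof (rule inj)
      show "s [^] i \<otimes> v \<in> carrier R #> (s [^] ?n)" using Rx(4) v s by blast
      show "s [^] i \<otimes> v \<otimes> s [^] i = ?e \<otimes> s [^] i"
        using v s vs comm by (simp add: m_assoc)
    qed (rule e)
    then show ?thesis using v vs by blast
  qed
  then show ?thesis
    using s e(2) pow_e assms(2) ring_axioms
    by (simp add: fitting_idempotent_def fitting_idempotent_axioms_def)
qed

text \<open>Where \<open>S\<close> is invertible already modulo \<open>ass S\<close>, every fraction can be written with denominator \<open>1\<close>.\<close>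
lemma (in ring) left_localization_iso_quotient:
  assumes S: "S \<in> Den_l R" and I: "ideal I R" "ass R S = I"
    and inv: "\<And>s. s \<in> S \<Longrightarrow> \<exists>v\<in>carrier R. \<one> \<ominus> v \<otimes> s \<in> I \<and> \<one> \<ominus> s \<otimes> v \<in> I"
  shows "R Quot I \<simeq> left_localization R S"
proof -
  interpret I: ideal I R by (rule I)
  have hom: "(+>) I \<in> ring_hom R (R Quot I)" by (rule I.rcos_ring_hom)
  show ?thesis
  proof (rule left_localization_iso[OF S I.quotient_is_ring hom])
    fix s assume s: "s \<in> S"
    then have sR: "s \<in> carrier R"
      using S by (auto simp: Den_l_def left_ore_set_def multiplicative_set_def)
    obtain v where v: "v \<in> carrier R" "\<one> \<ominus> v \<otimes> s \<in> I" "\<one> \<ominus> s \<otimes> v \<in> I"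
      using inv[OF s] by blast
    then have "I +> v \<otimes> s = I +> \<one>" "I +> s \<otimes> v = I +> \<one>"
      using quotient_eq_iff_same_a_r_cos[OF I(1), of \<one>] sR by auto
    then have "(I +> v) \<otimes>\<^bsub>R Quot I\<^esub> (I +> s) = \<one>\<^bsub>R Quot I\<^esub>"
      "(I +> s) \<otimes>\<^bsub>R Quot I\<^esub> (I +> v) = \<one>\<^bsub>R Quot I\<^esub>"
      using ring_hom_mult[OF hom] ring_hom_one[OF hom] v(1) sR by metis+
    then show "I +> s \<in> Units (R Quot I)"
      using ring_hom_closed[OF hom] v(1) sR unfolding Units_def by blast
  next
    fix r assume r: "r \<in> carrier R" "I +> r = \<zero>\<^bsub>R Quot I\<^esub>"
    then have "I +> r = I" by (simp add: FactRing_def)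
    then show "r \<in> ass R S" using I.a_rcos_self[OF r(1)] I(2) by simp
  next
    fix q assume q: "q \<in> carrier (R Quot I)"
    then obtain r where r: "r \<in> carrier R" "q = I +> r"
      by (auto simp: FactRing_def A_RCOSETS_def')
    interpret Q: ring "R Quot I" by (rule I.quotient_is_ring)
    have "(I +> \<one>) \<otimes>\<^bsub>R Quot I\<^esub> q = I +> r"
      using ring_hom_one[OF hom] q r(2) by simp
    moreover have "\<one> \<in> S"
      using S by (auto simp: Den_l_def left_ore_set_def multiplicative_set_def)
    ultimately show "\<exists>s\<in>S. \<exists>r\<in>carrier R. (I +> s) \<otimes>\<^bsub>R Quot I\<^esub> q = I +> r"
      using r(1) by blast
  qed
qed

section \<open>Denominator sets of powers and of an idempotent\<close>

context fitting_idempotent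
begin

abbreviation "e' \<equiv> \<one> \<ominus> e"
abbreviation "powers \<equiv> {s [^] i | i :: nat. True}"

text \<open>The condition \<open>eRe' = 0\<close>: in the Peirce decomposition for \<open>e\<close> and \<open>e'\<close>, the ring is triangular.\<close>
definition triangular :: bool where
  "triangular \<longleftrightarrow> (\<forall>r\<in>carrier R. e \<otimes> r \<otimes> e' = \<zero>)"

lemma e'_closed: "e' \<in> carrier R"
  using e_closed by simp

lemma pow_closed: "s [^] (i::nat) \<in> carrier R"
  using s_closed by simp

lemma e_pow: "e \<otimes> s [^] (i::nat) = s [^] i \<otimes> e"
proof -
  obtain v where v: "v \<in> carrier R" "v \<otimes> s [^] i = e" "s [^] i \<otimes> v = e"
    using corner_inverse by blast
  have "e \<otimes> s [^] i = s [^] i \<otimes> (v \<otimes> s [^] i)"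
    using v(1,3) s_closed by (metis m_assoc nat_pow_closed)
  then show ?thesis by (simp add: v(2))
qed

lemma e_idem: "e \<otimes> e = e"
proof -
  obtain v where v: "v \<in> carrier R" "v \<otimes> s [^] n = e" using corner_inverse by blast
  have "(v \<otimes> s [^] n) \<otimes> e = v \<otimes> s [^] n"
    using v(1) pow_e pow_closed e_closed by (simp add: m_assoc)
  then show ?thesis using v(2) by simp
qed

lemma pow_nonzero: "s [^] (i::nat) \<noteq> \<zero>"
  using not_nilpotent by (auto simp: nilpotent_elem_def)

lemma e_nonzero: "e \<noteq> \<zero>"
  using pow_e pow_nonzero[of n] s_closed by auto

lemma e_e': "e \<otimes> e' = \<zero>" and e'_e: "e' \<otimes> e = \<zero>" and pow_e': "s [^] n \<otimes> e' = \<zero>"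
  using e_closed e_idem pow_e pow_closed
  by (simp_all add: minus_eq l_distr r_distr l_minus r_minus r_neg)

lemma e'_idem: "e' \<otimes> e' = e'"
proof -
  have "e' \<otimes> e' = e' \<otimes> \<one> \<ominus> e' \<otimes> e"
    using e_closed by (simp add: minus_eq r_distr r_minus)
  then show ?thesis using e'_e e_closed by (simp add: minus_eq)
qed

lemma e'_pow: "e' \<otimes> s [^] (i::nat) = s [^] i \<otimes> e'"
  using e_closed e_pow pow_closed by (simp add: minus_eq l_distr r_distr l_minus r_minus)

lemma e'_mult: "r \<in> carrier R \<Longrightarrow> e' \<otimes> r = r \<ominus> e \<otimes> r"
  using e_closed by (simp add: minus_eq l_distr l_minus)

lemma mult_e': "r \<in> carrier R \<Longrightarrow> r \<otimes> e' = r \<ominus> r \<otimes> e"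
  using e_closed by (simp add: minus_eq r_distr r_minus)

lemma mem_e'R_iff: "x \<in> {e' \<otimes> r | r. r \<in> carrier R} \<longleftrightarrow> x \<in> carrier R \<and> e \<otimes> x = \<zero>"
proof
  assume "x \<in> {e' \<otimes> r | r. r \<in> carrier R}"
  then obtain r where r: "r \<in> carrier R" "x = e' \<otimes> r" by blast
  have "e \<otimes> (e' \<otimes> r) = (e \<otimes> e') \<otimes> r" using r(1) e_closed e'_closed by (simp only: m_assoc)
  then show "x \<in> carrier R \<and> e \<otimes> x = \<zero>" using r e'_closed by (simp add: e_e')
next
  assume x: "x \<in> carrier R \<and> e \<otimes> x = \<zero>"
  then have "e' \<otimes> x = x \<ominus> e \<otimes> x" by (intro e'_mult) simp
  then have "x = e' \<otimes> x" using x by (simp add: minus_eq)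
  then show "x \<in> {e' \<otimes> r | r. r \<in> carrier R}" using x by blast
qed

lemma triangularD:
  assumes triangular "r \<in> carrier R"
  shows "e \<otimes> r \<otimes> e = e \<otimes> r"
proof -
  have c: "e \<otimes> r \<in> carrier R" "e \<otimes> r \<otimes> e \<in> carrier R" using assms e_closed by auto
  have "e \<otimes> r \<ominus> e \<otimes> r \<otimes> e = \<zero>"
    using assms mult_e'[OF c(1)] by (simp add: triangular_def)
  then show ?thesis using minus_eq_zero_iff[OF c] by simp
qed

lemma e_kills_if_pow_kills:
  assumes "r \<in> carrier R" "s [^] (i::nat) \<otimes> r = \<zero>"
  shows "e \<otimes> r = \<zero>"
proof -
  obtain v where v: "v \<in> carrier R" "v \<otimes> s [^] i = e" using corner_inverse by blast
  have "(v \<otimes> s [^] i) \<otimes> r = \<zero>" using assms v(1) pow_closed by (simp add: m_assoc)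
  then show ?thesis by (simp add: v(2))
qed

lemma pow_kills_if_e_kills:
  assumes "r \<in> carrier R" "e \<otimes> r = \<zero>"
  shows "s [^] n \<otimes> r = \<zero>"
proof -
  have "s [^] n \<otimes> r = s [^] n \<otimes> (e \<otimes> r)"
    using assms(1) pow_closed e_closed by (simp add: m_assoc[symmetric] pow_e)
  then show ?thesis using assms(2) pow_closed by simp
qed

text \<open>As \<open>e'\<close> commutes with \<open>s\<close>, the positive powers of \<open>e'se'\<close> are \<open>s\<^sup>k e'\<close>, and \<open>s\<^sup>n e' = 0\<close>.\<close>
lemma nilpotent_part: "nilpotent_elem R (e' \<otimes> s \<otimes> e')"
proof -
  have c: "e' \<otimes> s \<otimes> e' \<in> carrier R" using e'_closed s_closed by simp
  have e's: "e' \<otimes> s \<otimes> e' = s \<otimes> e'"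
    using e'_pow[of 1] e'_closed s_closed by (simp add: m_assoc e'_idem)
  have pow: "(s \<otimes> e') [^] k \<otimes> e' = s [^] k \<otimes> e'" for k :: nat
  proof (induction k)
    case (Suc k)
    have "(s \<otimes> e') [^] Suc k \<otimes> e' = (s \<otimes> e') [^] k \<otimes> (s \<otimes> (e' \<otimes> e'))"
      using e'_closed s_closed by (simp add: m_assoc)
    also have "\<dots> = (s \<otimes> e') [^] k \<otimes> e' \<otimes> s"
      using e'_pow[of 1] e'_closed s_closed by (simp add: e'_idem m_assoc)
    also have "\<dots> = s [^] Suc k \<otimes> e'"
      unfolding Suc.IH using e'_pow[of 1] e'_closed s_closed by (simp add: m_assoc)
    finally show ?case .
  qed (use e'_closed in simp)
  have "(s \<otimes> e') [^] Suc n = (s \<otimes> e') [^] n \<otimes> e' \<otimes> s"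
    using e'_pow[of 1] e'_closed s_closed by (simp add: m_assoc)
  also have "\<dots> = \<zero>" unfolding pow pow_e' using s_closed by simp
  finally show ?thesis unfolding nilpotent_elem_def e's by blast
qed

text \<open>An element \<open>a\<close> of \<open>eRe'\<close> satisfies \<open>a s\<^sup>n = 0\<close>, so in a left denominator set some
  \<open>s\<^sup>i\<close> kills it from the left, whence \<open>a = ea = 0\<close>. Conversely, write \<open>e = v s\<^sup>i\<close>: then
  \<open>s\<^sup>n r = s\<^sup>n ere\<close> is a left multiple of \<open>s\<^sup>i\<close>. And if \<open>r s\<^sup>i = 0\<close>, then
  \<open>re = 0\<close>, so \<open>er = ere = 0\<close> and \<open>s\<^sup>n r = 0\<close>.\<close>
lemma powers_Den_l_iff: "powers \<in> Den_l R \<longleftrightarrow> triangular"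
proof
  assume D: "powers \<in> Den_l R"
  show triangular
    unfolding triangular_def
  proof
    fix r assume r: "r \<in> carrier R"
    let ?a = "e \<otimes> r \<otimes> e'"
    have a: "?a \<in> carrier R" using r e_closed e'_closed by simp
    have "?a \<otimes> s [^] n = e \<otimes> r \<otimes> (e' \<otimes> s [^] n)"
      using r e_closed e'_closed pow_closed by (simp only: m_assoc m_closed)
    then have "?a \<otimes> s [^] n = \<zero>" using r e_closed by (simp add: e'_pow pow_e')
    then obtain i :: nat where "s [^] i \<otimes> ?a = \<zero>"
      using D a by (auto simp: Den_l_def)
    then have "e \<otimes> ?a = \<zero>" using a by (rule e_kills_if_pow_kills[rotated])
    then show "?a = \<zero>" using r e_closed e'_closed by (simp add: m_assoc[symmetric] e_idem)
  qed
next
  assume T: triangular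
  have mult: "multiplicative_set R powers"
  proof -
    have "s [^] i \<otimes> s [^] j = s [^] (i + j)" for i j :: nat
      using s_closed by (simp add: nat_pow_mult)
    moreover have "\<one> = s [^] (0::nat)" by simp
    ultimately show ?thesis
      unfolding multiplicative_set_def using pow_closed pow_nonzero by (auto, metis+)
  qed
  have ore: "(powers #> r) \<inter> (carrier R #> s [^] i) \<noteq> {}" if r: "r \<in> carrier R" for r and i :: nat
  proof -
    obtain v where v: "v \<in> carrier R" "v \<otimes> s [^] i = e" using corner_inverse by blast
    have "s [^] n \<otimes> r = s [^] n \<otimes> (e \<otimes> r)"
      using r pow_closed e_closed by (simp add: m_assoc[symmetric] pow_e)
    also have "e \<otimes> r = e \<otimes> r \<otimes> (v \<otimes> s [^] i)"
      using triangularD[OF T r] v(2) by simp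
    finally have "s [^] n \<otimes> r = (s [^] n \<otimes> (e \<otimes> r \<otimes> v)) \<otimes> s [^] i"
      using r v(1) e_closed pow_closed by (simp add: m_assoc)
    then have "s [^] n \<otimes> r \<in> carrier R #> s [^] i"
      using r v(1) e_closed pow_closed unfolding mem_principal by blast
    moreover have "s [^] n \<otimes> r \<in> powers #> r" by (auto simp: r_coset_def)
    ultimately show ?thesis by blast
  qed
  have "\<exists>t\<in>powers. t \<otimes> r = \<zero>" if r: "r \<in> carrier R" and "r \<otimes> s [^] i = \<zero>" for r and i :: nat
  proof -
    obtain v where v: "v \<in> carrier R" "s [^] i \<otimes> v = e" using corner_inverse by blast
    have "r \<otimes> e = (r \<otimes> s [^] i) \<otimes> v"
      using r v(1) pow_closed by (simp add: m_assoc v(2))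
    then have "r \<otimes> e = \<zero>" using that v(1) by simp
    moreover have "e \<otimes> r = e \<otimes> (r \<otimes> e)"
      using triangularD[OF T r] r e_closed by (simp add: m_assoc)
    ultimately have "e \<otimes> r = \<zero>" using e_closed by simp
    then show ?thesis using pow_kills_if_e_kills[OF r] by blast
  qed
  then show "powers \<in> Den_l R"
    using mult ore by (auto simp: Den_l_def left_ore_set_def)
qed

text \<open>The same argument, with \<open>e\<close> in place of all powers of \<open>s\<close>.\<close>
lemma idempotent_Den_l_iff: "{\<one>, e} \<in> Den_l R \<longleftrightarrow> triangular"
proof
  assume D: "{\<one>, e} \<in> Den_l R"
  show triangular
    unfolding triangular_def
  proof
    fix r assume r: "r \<in> carrier R"
    let ?a = "e \<otimes> r \<otimes> e'"
    have a: "?a \<in> carrier R" using r e_closed e'_closed by simp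
    have "?a \<otimes> e = e \<otimes> r \<otimes> (e' \<otimes> e)"
      using r e_closed e'_closed by (simp only: m_assoc m_closed)
    then have "?a \<otimes> e = \<zero>" using r e_closed by (simp add: e'_e)
    then obtain t where "t \<in> {\<one>, e}" "t \<otimes> ?a = \<zero>"
      using D a unfolding Den_l_def by blast
    moreover have "e \<otimes> ?a = ?a"
      using r e_closed e'_closed by (simp add: m_assoc[symmetric] e_idem)
    ultimately show "?a = \<zero>" using a by auto
  qed
next
  assume T: triangular
  have nz: "\<one> \<noteq> \<zero>" using e_nonzero e_closed by (metis l_null l_one)
  have mult: "multiplicative_set R {\<one>, e}"
    using e_closed e_idem e_nonzero nz by (auto simp: multiplicative_set_def)
  have "({\<one>, e} #> r) \<inter> (carrier R #> t) \<noteq> {}"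
    if r: "r \<in> carrier R" and t: "t \<in> {\<one>, e}" for r t
  proof -
    have "e \<otimes> r \<in> carrier R #> \<one>" "e \<otimes> r \<in> carrier R #> e"
      using triangularD[OF T r] r e_closed unfolding mem_principal
      by (auto intro!: bexI[of _ "e \<otimes> r"])
    moreover have "e \<otimes> r \<in> {\<one>, e} #> r" by (auto simp: r_coset_def)
    ultimately show ?thesis using t by blast
  qed
  moreover have "\<exists>u\<in>{\<one>, e}. u \<otimes> r = \<zero>"
    if r: "r \<in> carrier R" and t: "t \<in> {\<one>, e}" "r \<otimes> t = \<zero>" for r t
  proof -
    have "e \<otimes> r \<otimes> e = e \<otimes> (r \<otimes> e)" using r e_closed by (simp add: m_assoc)
    then have "e \<otimes> r = \<zero>" using triangularD[OF T r] r t e_closed by auto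
    then show ?thesis by blast
  qed
  ultimately show "{\<one>, e} \<in> Den_l R"
    using mult unfolding Den_l_def left_ore_set_def by blast
qed

lemma ass_powers: "ass R powers = {e' \<otimes> r | r. r \<in> carrier R}"
proof (rule Set.set_eqI)
  show "x \<in> ass R powers \<longleftrightarrow> x \<in> {e' \<otimes> r | r. r \<in> carrier R}" for x
    unfolding mem_e'R_iff ass_def
    using e_kills_if_pow_kills pow_kills_if_e_kills by blast
qed

lemma ass_idempotent: "ass R {\<one>, e} = {e' \<otimes> r | r. r \<in> carrier R}"
proof (rule Set.set_eqI)
  show "x \<in> ass R {\<one>, e} \<longleftrightarrow> x \<in> {e' \<otimes> r | r. r \<in> carrier R}" for x
    unfolding mem_e'R_iff ass_def using e_closed by auto
qed

text \<open>Left closure is where \<open>eRe' = 0\<close> enters: if \<open>ex = 0\<close> then \<open>erx = erex = 0\<close>.\<close>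
lemma e'R_ideal:
  assumes triangular
  shows "ideal {e' \<otimes> r | r. r \<in> carrier R} R"
proof -
  let ?I = "{e' \<otimes> r | r. r \<in> carrier R}"
  have left: "r \<otimes> x \<in> ?I" if "r \<in> carrier R" "x \<in> ?I" for r x
  proof -
    have x: "x \<in> carrier R" "e \<otimes> x = \<zero>" using that mem_e'R_iff by auto
    have "e \<otimes> (r \<otimes> x) = (e \<otimes> r \<otimes> e) \<otimes> x"
      using that(1) x(1) e_closed by (simp add: m_assoc[symmetric] triangularD[OF assms])
    also have "\<dots> = \<zero>" using that(1) x e_closed by (simp add: m_assoc)
    finally show ?thesis using that(1) x(1) by (simp add: mem_e'R_iff del: mem_Collect_eq)
  qed
  have "left_ideal ?I R"
    by (rule left_idealI) (use left e_closed in \<open>auto simp: mem_e'R_iff r_distr simp del: mem_Collect_eq\<close>)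
  moreover have "x \<otimes> r \<in> ?I" if "r \<in> carrier R" "x \<in> ?I" for r x
    using that e_closed by (simp add: mem_e'R_iff m_assoc[symmetric] del: mem_Collect_eq)
  ultimately show ?thesis
    using left by (intro idealI) (auto simp: left_ideal_def additive_subgroup_def ring_axioms)
qed

lemma localization_powers:
  assumes triangular
  shows "R Quot {e' \<otimes> r | r. r \<in> carrier R} \<simeq> left_localization R powers"
proof (rule left_localization_iso_quotient[OF _ e'R_ideal[OF assms] ass_powers])
  show "powers \<in> Den_l R" using assms powers_Den_l_iff by blast
  fix t assume "t \<in> powers"
  then obtain i :: nat where t: "t = s [^] i" by blast
  have "e' \<in> {e' \<otimes> r | r. r \<in> carrier R}"
    using e_e' e'_closed by (simp add: mem_e'R_iff del: mem_Collect_eq)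
  moreover obtain v where "v \<in> carrier R" "v \<otimes> t = e" "t \<otimes> v = e"
    using corner_inverse[of i] unfolding t by blast
  ultimately show "\<exists>v\<in>carrier R. \<one> \<ominus> v \<otimes> t \<in> {e' \<otimes> r | r. r \<in> carrier R}
      \<and> \<one> \<ominus> t \<otimes> v \<in> {e' \<otimes> r | r. r \<in> carrier R}"
    by (intro bexI[of _ v]) (simp_all only: simp_thms)
qed

lemma localization_idempotent:
  assumes triangular
  shows "R Quot {e' \<otimes> r | r. r \<in> carrier R} \<simeq> left_localization R {\<one>, e}"
proof (rule left_localization_iso_quotient[OF _ e'R_ideal[OF assms] ass_idempotent])
  show "{\<one>, e} \<in> Den_l R" using assms idempotent_Den_l_iff by blast
  fix t assume t: "t \<in> {\<one>, e}"
  have "e' \<in> {e' \<otimes> r | r. r \<in> carrier R}"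
    using e_e' e'_closed by (simp add: mem_e'R_iff del: mem_Collect_eq)
  moreover have "t \<otimes> e = e" "e \<otimes> t = e" using t e_closed e_idem by auto
  ultimately show "\<exists>v\<in>carrier R. \<one> \<ominus> v \<otimes> t \<in> {e' \<otimes> r | r. r \<in> carrier R}
      \<and> \<one> \<ominus> t \<otimes> v \<in> {e' \<otimes> r | r. r \<in> carrier R}"
    using e_closed by (intro bexI[of _ e]) (simp_all only: simp_thms)
qed

text \<open>Since \<open>e's\<^sup>i e' = s\<^sup>i e'\<close>, the condition says that \<open>s\<^sup>i\<close> already kills all of \<open>ass S = e'R\<close>.\<close>
lemma core_powers: "ore_core R powers = {s [^] i | i :: nat. e' \<otimes> s [^] i \<otimes> e' = \<zero>}"
proof -
  have e'se': "e' \<otimes> s [^] i \<otimes> e' = s [^] i \<otimes> e'" for i :: nat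
    using e'_closed pow_closed by (simp add: e'_pow m_assoc e'_idem)
  have "left_mult_ker R (s [^] i) = ass R powers \<longleftrightarrow> s [^] i \<otimes> e' = \<zero>" for i :: nat
  proof
    assume "left_mult_ker R (s [^] i) = ass R powers"
    moreover have "e' \<in> ass R powers"
      unfolding ass_powers using e_e' e'_closed by (simp add: mem_e'R_iff del: mem_Collect_eq)
    ultimately show "s [^] i \<otimes> e' = \<zero>" by (auto simp: left_mult_ker_def)
  next
    assume z: "s [^] i \<otimes> e' = \<zero>"
    have "s [^] i \<otimes> (e' \<otimes> r) = \<zero>" if "r \<in> carrier R" for r
      using that z e'_closed pow_closed by (simp add: m_assoc[symmetric])
    then have "ass R powers \<subseteq> left_mult_ker R (s [^] i)"
      unfolding ass_powers using e'_closed by (auto simp: left_mult_ker_def)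
    moreover have "left_mult_ker R (s [^] i) \<subseteq> ass R powers"
      by (auto simp: left_mult_ker_def ass_def)
    ultimately show "left_mult_ker R (s [^] i) = ass R powers" by blast
  qed
  then show ?thesis by (auto simp: ore_core_def e'se')
qed

end

section \<open>The equivalences, the localizations and the core\<close>

theorem theorem7p4:
  fixes R (structure) and s e :: 'a and S_e S_s e'R :: "'a set"
  assumes "ring R" and "\<one> \<noteq> \<zero>"
    and "left_artinian R"
    and "s \<in> carrier R" and "\<not> nilpotent_elem R s"
    and "e = assoc_idem R s"
    and "S_e = {\<one>, e}"
    and "S_s = {s [^] i | i :: nat. True}"
    and "e'R = {(\<one> \<ominus> e) \<otimes> r | r. r \<in> carrier R}"
  shows
    "(S_s \<in> Den_l R \<longleftrightarrow>
        S_e \<in> Den_l R \<and> nilpotent_elem R ((\<one> \<ominus> e) \<otimes> s \<otimes> (\<one> \<ominus> e))) \<and>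
     (S_s \<in> Den_l R \<longleftrightarrow>
        {e \<otimes> r \<otimes> (\<one> \<ominus> e) | r. r \<in> carrier R} = {\<zero>} \<and>
        nilpotent_elem R ((\<one> \<ominus> e) \<otimes> s \<otimes> (\<one> \<ominus> e))) \<and>
     (S_s \<in> Den_l R \<longrightarrow>
        ass R S_s = e'R \<and>
        ideal e'R R \<and>
        left_localization R S_s \<simeq> left_localization R S_e \<and>
        left_localization R S_e \<simeq> R Quot e'R \<and>
        ore_core R S_s = {s [^] i | i :: nat. (\<one> \<ominus> e) \<otimes> s [^] i \<otimes> (\<one> \<ominus> e) = \<zero>})"
proof -
  interpret left_artinian_ring R
    using assms by (simp add: left_artinian_ring_def left_artinian_ring_axioms_def)
  interpret fitting_idempotent R s e "stab_index R s"
    using assoc_idem_fitting assms by simp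
  have triangular_set: "triangular \<longleftrightarrow> {e \<otimes> r \<otimes> (\<one> \<ominus> e) | r. r \<in> carrier R} = {\<zero>}"
  proof
    assume T: triangular
    then have "e \<otimes> \<zero> \<otimes> (\<one> \<ominus> e) = \<zero>" by (simp add: triangular_def)
    then show "{e \<otimes> r \<otimes> (\<one> \<ominus> e) | r. r \<in> carrier R} = {\<zero>}"
      using T unfolding triangular_def by force
  qed (auto simp: triangular_def)
  have S: "S_s = powers" "S_e = {\<one>, e}" "e'R = {(\<one> \<ominus> e) \<otimes> r | r. r \<in> carrier R}"
    using assms by simp_all
  have "left_localization R S_s \<simeq> left_localization R S_e
      \<and> left_localization R S_e \<simeq> R Quot e'R" if T: triangular
  proof -
    have Q: "ring (R Quot e'R)"
      unfolding S using e'R_ideal[OF T] by (rule ideal.quotient_is_ring)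
    show ?thesis
      using ring_iso_trans[OF ring_iso_sym[OF Q] localization_idempotent[OF T, folded S]]
        ring_iso_sym[OF Q] localization_idempotent[OF T, folded S] localization_powers[OF T, folded S]
      by blast
  qed
  then show ?thesis
    using powers_Den_l_iff idempotent_Den_l_iff nilpotent_part triangular_set
      ass_powers e'R_ideal core_powers
    unfolding S by blast
qed

end
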